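(* Let $X$ be an infinite-dimensional Banach space over $\mathbb{K}=\mathbb{R}$ or $\mathbb{C}$, let $Y$ be a hereditarily indecomposable (infinite-dimensional closed) subspace of $X$, and let $T\colon Y\to X$ be an into isomorphism. Let $\mathrm{i}_{Y,X}\colon Y\to X$ denote the inclusion map. Then at least one of the following holds: $T$ is homotopic in $\mathrm{Emb}(Y,X)$ to $\mathrm{i}_{Y,X}$; or $T$ is homotopic in $\mathrm{Emb}(Y,X)$ to $-\mathrm{i}_{Y,X}$; or $T$ is homotopic in $\mathrm{Emb}(Y,X)$ to $\mathrm{i}_{Y,X}\circ R$ for every reflection $R$ of $Y$; or $T$ is homotopic in $\mathrm{Emb}(Y,X)$ to $\mathrm{i}_{Y,X}\circ A$ for every antireflection $A$ of $Y$. Moreover: 1. If $Y\neq X$, then $T$ is homotopic in $\mathrm{Emb}(Y,X)$ either to $\mathrm{i}_{Y,X}$ or to $-\mathrm{i}_{Y,X}$. 2. If $\mathbb{K}=\mathbb{C}$, then $T$ is homotopic in $\mathrm{Emb}(Y,X)$ to $\mathrm{i}_{Y,X}$.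
   Context: An infinite-dimensional Banach space is hereditarily indecomposable (HI) if no two infinite-dimensional closed subspaces of it are in topological direct sum. All operators are bounded and linear. An operator $T\colon Y\to X$ is an into isomorphism if there is $c>0$ with $\|T(y)\|\geqslant c\|y\|$ for all $y\in Y$. $\mathrm{Emb}(Y,X)$ is the set of all into isomorphisms $Y\to X$, with the operator-norm topology. Two elements $S,T\in\mathrm{Emb}(Y,X)$ are homotopic in $\mathrm{Emb}(Y,X)$ if there is a continuous map $[0,1]\to\mathrm{Emb}(Y,X)$, $t\mapsto T_t$, with $T_0=S$ and $T_1=T$. A reflection of $Y$ is an operator $R\colon Y\to Y$ for which there exist a closed hyperplane $H\subseteq Y$ and $x_0\in Y\setminus\{0\}$ such that $R(x)=x$ for all $x\in H$ and $R(x_0)=-x_0$. An antireflection of $Y$ is an operator of the form $-R$ with $R$ a reflection of $Y$. *)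

theory Defs
  imports "HOL-Analysis.Analysis"
begin

text \<open>
  Normed spaces over a normed field \<open>'k\<close>, to be used with \<open>'k = real\<close> (where \<open>smul\<close> is
  \<open>scaleR\<close>) and \<open>'k = complex\<close>.  A complex Banach space is a type of class \<open>banach\<close> together
  with a complex scalar multiplication that extends the real one and for which the norm is
  homogeneous.
\<close>

locale normed_space_over = vector_space smul
  for smul :: "'k::real_normed_field \<Rightarrow> 'a::real_normed_vector \<Rightarrow> 'a" +
  assumes smul_of_real: "smul (of_real r) x = r *\<^sub>R x"
    and norm_smul: "norm (smul c x) = norm c * norm x"

lemma normed_space_over_scaleR:
  "normed_space_over ((*\<^sub>R) :: real \<Rightarrow> 'a::real_normed_vector \<Rightarrow> 'a)"
  by unfold_locales (auto simp: algebra_simps)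

definition infinite_dim ::
    "('k::field \<Rightarrow> 'a::ab_group_add \<Rightarrow> 'a) \<Rightarrow> 'a set \<Rightarrow> bool"
  where "infinite_dim smul V \<longleftrightarrow> \<not> (\<exists>B. finite B \<and> V \<subseteq> module.span smul B)"

definition closed_subspace ::
    "('k::real_normed_field \<Rightarrow> 'a::real_normed_vector \<Rightarrow> 'a) \<Rightarrow> 'a set \<Rightarrow> bool"
  where "closed_subspace smul V \<longleftrightarrow> module.subspace smul V \<and> closed V"

definition topological_direct_sum :: "'a::real_normed_vector set \<Rightarrow> 'a set \<Rightarrow> bool"
  where "topological_direct_sum U V \<longleftrightarrow>
    U \<inter> V = {0} \<and>
    (\<exists>g. homeomorphism (U \<times> V) ((\<lambda>(u, v). u + v) ` (U \<times> V)) (\<lambda>(u, v). u + v) g)"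

definition hereditarily_indecomposable ::
    "('k::real_normed_field \<Rightarrow> 'a::real_normed_vector \<Rightarrow> 'a) \<Rightarrow> 'a set \<Rightarrow> bool"
  where "hereditarily_indecomposable smul Y \<longleftrightarrow>
    infinite_dim smul Y \<and>
    \<not> (\<exists>U V. U \<subseteq> Y \<and> V \<subseteq> Y \<and>
          closed_subspace smul U \<and> infinite_dim smul U \<and>
          closed_subspace smul V \<and> infinite_dim smul V \<and>
          topological_direct_sum U V)"

text \<open>
  Operators between subspaces \<open>Y\<close> and \<open>Z\<close> are extensional functions (\<open>undefined\<close> outside \<open>Y\<close>),
  so that two operators are equal iff they agree on \<open>Y\<close>.
\<close>

definition operators ::
    "('k::real_normed_field \<Rightarrow> 'a::real_normed_vector \<Rightarrow> 'a) \<Rightarrow> 'a set \<Rightarrow> 'a set \<Rightarrow> ('a \<Rightarrow> 'a) set"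
  where "operators smul Y Z =
    {T \<in> Y \<rightarrow>\<^sub>E Z.
       (\<forall>x\<in>Y. \<forall>y\<in>Y. T (x + y) = T x + T y) \<and>
       (\<forall>c. \<forall>x\<in>Y. T (smul c x) = smul c (T x)) \<and>
       (\<exists>C. \<forall>x\<in>Y. norm (T x) \<le> C * norm x)}"

text \<open>
  The value 0 for functions unbounded on the unit ball of \<open>Y\<close> is never used on operators; it only
  makes the distance below nonnegative on all pairs of functions, as \<open>Metric_space\<close> demands.
\<close>

definition op_norm :: "'a::real_normed_vector set \<Rightarrow> ('a \<Rightarrow> 'a) \<Rightarrow> real"
  where "op_norm Y T =
    (if bdd_above ((\<lambda>y. norm (T y)) ` {y \<in> Y. norm y \<le> 1})
     then (SUP y \<in> {y \<in> Y. norm y \<le> 1}. norm (T y)) else 0)"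

definition Emb ::
    "('k::real_normed_field \<Rightarrow> 'a::real_normed_vector \<Rightarrow> 'a) \<Rightarrow> 'a set \<Rightarrow> 'a set \<Rightarrow> ('a \<Rightarrow> 'a) set"
  where "Emb smul Y Z =
    {T \<in> operators smul Y Z. \<exists>c>0. \<forall>y\<in>Y. norm (T y) \<ge> c * norm y}"

definition Emb_topology ::
    "('k::real_normed_field \<Rightarrow> 'a::real_normed_vector \<Rightarrow> 'a) \<Rightarrow> 'a set \<Rightarrow> 'a set \<Rightarrow> ('a \<Rightarrow> 'a) topology"
  where "Emb_topology smul Y Z =
    Metric_space.mtopology (Emb smul Y Z) (\<lambda>S T. op_norm Y (\<lambda>y. S y - T y))"

text \<open>\<^const>\<open>Metric_space.mtopology\<close> is only meaningful for a metric, which the operator-norm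
  distance is:\<close>

lemma (in normed_space_over) Metric_space_Emb:
  assumes Y: "subspace Y"
  shows "Metric_space (Emb smul Y Z) (\<lambda>S T. op_norm Y (\<lambda>y. S y - T y))"
proof -
  let ?B = "{y \<in> Y. norm y \<le> 1}"
  let ?M = "Emb smul Y Z"
  have zero: "0 \<in> ?B"
    using Y by (simp add: subspace_0)
  have bdd: "bdd_above ((\<lambda>y. norm (S y - T y)) ` ?B)" if ST: "S \<in> ?M" "T \<in> ?M" for S T
  proof -
    obtain C D where C: "\<forall>x\<in>Y. norm (S x) \<le> C * norm x" and D: "\<forall>x\<in>Y. norm (T x) \<le> D * norm x"
      using ST unfolding Emb_def operators_def by auto
    have "norm (S y - T y) \<le> \<bar>C\<bar> + \<bar>D\<bar>" if "y \<in> ?B" for y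
    proof -
      have y: "y \<in> Y" "norm y \<le> 1"
        using that by auto
      have "norm (S y) \<le> C * norm y" "norm (T y) \<le> D * norm y"
        using C D y by auto
      moreover have "c * norm y \<le> \<bar>c\<bar>" for c
      proof -
        have "c * norm y \<le> \<bar>c\<bar> * norm y"
          by (intro mult_right_mono) auto
        also have "\<dots> \<le> \<bar>c\<bar> * 1"
          using y by (intro mult_left_mono) auto
        finally show ?thesis by simp
      qed
      ultimately show ?thesis
        using norm_triangle_ineq4[of "S y" "T y"] by (smt (verit))
    qed
    then show ?thesis
      by (intro bdd_aboveI2)
  qed
  have le: "norm (S y - T y) \<le> op_norm Y (\<lambda>y. S y - T y)"
    if "S \<in> ?M" "T \<in> ?M" "y \<in> ?B" for S T y
    using bdd[OF that(1,2)] that(3) unfolding op_norm_def by (auto intro: cSUP_upper2)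
  show ?thesis
  proof
    fix S T :: "'a \<Rightarrow> 'a"
    show "0 \<le> op_norm Y (\<lambda>y. S y - T y)"
      using zero unfolding op_norm_def by (auto intro: cSUP_upper2)
    show "op_norm Y (\<lambda>y. S y - T y) = op_norm Y (\<lambda>y. T y - S y)"
      unfolding op_norm_def by (simp add: norm_minus_commute)
  next
    fix S T assume ST: "S \<in> ?M" "T \<in> ?M"
    show "op_norm Y (\<lambda>y. S y - T y) = 0 \<longleftrightarrow> S = T"
    proof
      assume "S = T"
      have "(\<lambda>y. norm (0::'a)) ` ?B = {0}" using zero by auto
      then show "op_norm Y (\<lambda>y. S y - T y) = 0"
        using \<open>S = T\<close> unfolding op_norm_def by simp
    next
      assume 0: "op_norm Y (\<lambda>y. S y - T y) = 0"
      have hom: "S (smul c x) = smul c (S x)" "T (smul c x) = smul c (T x)" if "x \<in> Y" for c x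
        using ST that unfolding Emb_def operators_def by auto
      have ext: "S \<in> extensional Y" "T \<in> extensional Y"
        using ST unfolding Emb_def operators_def by (auto simp: PiE_def)
      show "S = T"
      proof (rule extensionalityI[OF ext])
        fix y assume y: "y \<in> Y"
        show "S y = T y"
        proof (cases "y = 0")
          case True
          then show ?thesis using le[OF ST zero] 0 by simp
        next
          case False
          let ?c = "of_real (1 / norm y) :: 'k"
          have "smul ?c y \<in> ?B"
            using Y y False by (auto simp: subspace_scale norm_smul norm_divide)
          then have "S (smul ?c y) = T (smul ?c y)"
            using le[OF ST, of "smul ?c y"] 0 by simp
          then show ?thesis
            using hom y False by simp
        qed
      qed
    qed
  next
    fix S T U assume STU: "S \<in> ?M" "T \<in> ?M" "U \<in> ?M"
    have "norm (S y - U y) \<le> op_norm Y (\<lambda>y. S y - T y) + op_norm Y (\<lambda>y. T y - U y)"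
      if "y \<in> ?B" for y
      using le[OF STU(1,2) that] le[OF STU(2,3) that] norm_triangle_ineq[of "S y - T y" "T y - U y"]
      by simp
    then have "(SUP y\<in>?B. norm (S y - U y)) \<le>
        op_norm Y (\<lambda>y. S y - T y) + op_norm Y (\<lambda>y. T y - U y)"
      using zero by (intro cSUP_least) blast+
    then show "op_norm Y (\<lambda>y. S y - U y) \<le> op_norm Y (\<lambda>y. S y - T y) + op_norm Y (\<lambda>y. T y - U y)"
      using bdd[OF STU(1,3)] unfolding op_norm_def[of Y "\<lambda>y. S y - U y"] by simp
  qed
qed

definition homotopic_in_Emb ::
    "('k::real_normed_field \<Rightarrow> 'a::real_normed_vector \<Rightarrow> 'a) \<Rightarrow> 'a set \<Rightarrow> 'a set \<Rightarrow>
      ('a \<Rightarrow> 'a) \<Rightarrow> ('a \<Rightarrow> 'a) \<Rightarrow> bool"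
  where "homotopic_in_Emb smul Y Z S T \<longleftrightarrow>
    path_component_of (Emb_topology smul Y Z) S T"

definition closed_hyperplane ::
    "('k::real_normed_field \<Rightarrow> 'a::real_normed_vector \<Rightarrow> 'a) \<Rightarrow> 'a set \<Rightarrow> 'a set \<Rightarrow> bool"
  where "closed_hyperplane smul Y H \<longleftrightarrow>
    closed_subspace smul H \<and> H \<subseteq> Y \<and> (\<exists>v\<in>Y - H. Y = module.span smul (insert v H))"

definition reflection ::
    "('k::real_normed_field \<Rightarrow> 'a::real_normed_vector \<Rightarrow> 'a) \<Rightarrow> 'a set \<Rightarrow> ('a \<Rightarrow> 'a) \<Rightarrow> bool"
  where "reflection smul Y R \<longleftrightarrow>
    R \<in> operators smul Y Y \<and>
    (\<exists>H. \<exists>x\<^sub>0\<in>Y - {0}. closed_hyperplane smul Y H \<and> (\<forall>x\<in>H. R x = x) \<and> R x\<^sub>0 = - x\<^sub>0)"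

definition antireflection ::
    "('k::real_normed_field \<Rightarrow> 'a::real_normed_vector \<Rightarrow> 'a) \<Rightarrow> 'a set \<Rightarrow> ('a \<Rightarrow> 'a) \<Rightarrow> bool"
  where "antireflection smul Y A \<longleftrightarrow> (\<exists>R. reflection smul Y R \<and> A = (\<lambda>y\<in>Y. - R y))"

definition incl :: "'a set \<Rightarrow> 'a \<Rightarrow> 'a"
  where "incl Y = (\<lambda>y\<in>Y. y)"

end

theory Submission
  imports Defs
begin

text \<open>
  On a hereditarily indecomposable \<open>Y\<close>, let \<open>A\<close> and \<open>B\<close> be operators into \<open>X\<close> that are bounded below on no
  finite-codimensional subspace. Each of them is small on some infinite-dimensional subspace, and
  these two subspaces almost meet, so that no combination of \<open>A\<close> and \<open>B\<close> is bounded below. Hence one of the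
  segments from \<open>T\<close> or \<open>- T\<close> to the inclusion consists of operators bounded below in finite codimension,
  and by compactness a single subspace of finite codimension serves the whole segment: there
  \<open>T\<close> or \<open>- T\<close> is homotopic to the inclusion. This homotopy is extended one dimension at a time. The
  value at the new vector can always be carried along the path, and at the end it is moved
  through the complement of the hyperplane already fixed. That complement is connected unless the field
  is real and the enlarged space is all of \<open>X\<close>, where its second component yields a
  reflection.
\<close>

section \<open>Norming functionals\<close>

text \<open>After its first extension a homotopy is no longer a segment, so arbitrary paths of
  embeddings have to be carried from a hyperplane to the enlarged space. The path is not subdivided:
  the embeddings of the hyperplane that have a suitable extension form a set that is both open and
  closed. This rests on a perturbation radius that depends only on the lower bound on the
  hyperplane; the extensions reached along the way may have arbitrarily bad lower bounds.

  Finite codimension is expressed by the common kernel of finitely many bounded functionals, which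
  can be removed one at a time. Norming functionals serve to build the infinite-dimensional
  subspaces on which an operator is small: they control the coefficients of a sequence chosen
  inductively. Control up to a constant is enough there, hence the factor 2, which leaves room to
  complexify a real norming functional.\<close>

definition sublinear :: "('a::real_vector \<Rightarrow> real) \<Rightarrow> bool" where
  "sublinear p \<longleftrightarrow> (\<forall>x y. p (x + y) \<le> p x + p y) \<and> (\<forall>r x. 0 \<le> r \<longrightarrow> p (r *\<^sub>R x) \<le> r * p x)"

lemma sublinearD:
  assumes "sublinear p"
  shows sublinear_add: "p (x + y) \<le> p x + p y"
    and sublinear_scale: "0 \<le> r \<Longrightarrow> p (r *\<^sub>R x) = r * p x"
    and sublinear_zero: "p 0 = 0"
    and sublinear_minus: "- p (- x) \<le> p x"
proof -
  have add: "p (x + y) \<le> p x + p y" and le: "0 \<le> r \<Longrightarrow> p (r *\<^sub>R x) \<le> r * p x" for x y r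
    using assms by (auto simp: sublinear_def)
  show "p (x + y) \<le> p x + p y" by (rule add)
  show zero: "p 0 = 0"
    using add[of 0 0] le[of 0 0] by simp
  show "- p (- x) \<le> p x"
    using add[of x "- x"] zero by simp
  show "p (r *\<^sub>R x) = r * p x" if "0 \<le> r"
  proof (cases "r = 0")
    case False
    then have "p x \<le> (1 / r) * p (r *\<^sub>R x)"
      using le[of "1 / r" "r *\<^sub>R x"] that by simp
    then show ?thesis
      using le[OF that, of x] that False by (simp add: field_simps)
  qed (simp add: zero)
qed

lemma sublinear_norm: "sublinear norm"
  by (simp add: sublinear_def norm_triangle_ineq)

text \<open>The auxiliary functional of the Hahn-Banach proof by minimal sublinear functionals.
  Taking \<open>t = 0\<close> shows that it lies below \<open>p\<close>; taking \<open>t = 1\<close>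
  bounds its value at \<open>- y\<close> by \<open>- p y\<close>. Hence a linear functional below it
  agrees with \<open>p\<close> at \<open>y\<close>.\<close>

definition tilt :: "('a::real_vector \<Rightarrow> real) \<Rightarrow> 'a \<Rightarrow> 'a \<Rightarrow> real" where
  "tilt p y x = (INF t\<in>{0..}. p (x + t *\<^sub>R y) - t * p y)"

lemma tilt_le:
  assumes "sublinear p" "0 \<le> t"
  shows "tilt p y x \<le> p (x + t *\<^sub>R y) - t * p y"
  unfolding tilt_def
proof (rule cINF_lower)
  show "bdd_below ((\<lambda>t. p (x + t *\<^sub>R y) - t * p y) ` {0..})"
  proof (rule bdd_belowI2)
    fix t :: real assume "t \<in> {0..}"
    then show "- p (- x) \<le> p (x + t *\<^sub>R y) - t * p y"
      using sublinear_add[OF assms(1), of "x + t *\<^sub>R y" "- x"] sublinear_scale[OF assms(1), of t y]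
      by simp
  qed
qed (use assms in simp)

lemma tilt_greatest:
  assumes "\<And>t. 0 \<le> t \<Longrightarrow> a \<le> p (x + t *\<^sub>R y) - t * p y"
  shows "a \<le> tilt p y x"
  unfolding tilt_def by (rule cINF_greatest) (use assms in auto)

lemma sublinear_tilt:
  assumes p: "sublinear p"
  shows "sublinear (tilt p y)"
  unfolding sublinear_def
proof (intro conjI allI impI)
  fix x x'
  have "tilt p y (x + x') - (p (x + t *\<^sub>R y) - t * p y) \<le> p (x' + t' *\<^sub>R y) - t' * p y"
    if "0 \<le> t" "0 \<le> t'" for t t'
    using tilt_le[OF p, of "t + t'" y "x + x'"] sublinear_add[OF p, of "x + t *\<^sub>R y" "x' + t' *\<^sub>R y"] that
    by (simp add: algebra_simps)
  then have "tilt p y (x + x') - (p (x + t *\<^sub>R y) - t * p y) \<le> tilt p y x'" if "0 \<le> t" for t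
    using that by (intro tilt_greatest) auto
  then have "tilt p y (x + x') - tilt p y x' \<le> tilt p y x"
    by (intro tilt_greatest) (auto simp: algebra_simps)
  then show "tilt p y (x + x') \<le> tilt p y x + tilt p y x'" by simp
next
  fix r :: real and x assume r: "0 \<le> r"
  show "tilt p y (r *\<^sub>R x) \<le> r * tilt p y x"
  proof (cases "r = 0")
    case True
    then show ?thesis using tilt_le[OF p, of 0 y 0] sublinear_zero[OF p] by simp
  next
    case False
    have "tilt p y (r *\<^sub>R x) / r \<le> tilt p y x"
    proof (rule tilt_greatest)
      fix t :: real assume t: "0 \<le> t"
      have "tilt p y (r *\<^sub>R x) \<le> p (r *\<^sub>R (x + t *\<^sub>R y)) - r * t * p y"
        using tilt_le[OF p, of "r * t" y "r *\<^sub>R x"] r t by (simp add: algebra_simps)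
      also have "\<dots> = (p (x + t *\<^sub>R y) - t * p y) * r"
        unfolding sublinear_scale[OF p r] by (simp add: algebra_simps)
      finally show "tilt p y (r *\<^sub>R x) / r \<le> p (x + t *\<^sub>R y) - t * p y"
        using r False by (simp add: divide_le_eq)
    qed
    then show ?thesis using r False by (simp add: field_simps)
  qed
qed

text \<open>Zorn's lemma for the reversed order; a chain is bounded by its pointwise infimum. That
  infimum is finite because members \<open>q\<close> of the chain satisfy
  \<open>- p (- x) \<le> q x\<close>, and it is subadditive because, of two members of a chain, the
  smaller one can be used at both points.\<close>

lemma exists_minimal_sublinear:
  assumes p: "sublinear (p :: 'a::real_vector \<Rightarrow> real)"
  obtains q where "sublinear q" "q \<le> p" "\<And>q'. sublinear q' \<Longrightarrow> q' \<le> q \<Longrightarrow> q' = q"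
proof -
  define A where "A = {q. sublinear q \<and> q \<le> p}"
  have "\<exists>q\<in>A. \<forall>q'\<in>A. q' \<le> q \<longrightarrow> q' = q"
  proof (rule predicate_Zorn[where P = "\<lambda>q q'. q' \<le> q"])
    show "partial_order_on A (relation_of (\<lambda>q q'. q' \<le> q) A)"
      by (rule partial_order_on_relation_ofI) auto
    fix C assume C: "C \<in> Chains (relation_of (\<lambda>q q'. q' \<le> q) A)"
    then have CA: "C \<subseteq> A" and tot: "\<And>q q'. q \<in> C \<Longrightarrow> q' \<in> C \<Longrightarrow> q \<le> q' \<or> q' \<le> q"
      by (auto simp: Chains_def relation_of_def)
    show "\<exists>u\<in>A. \<forall>q\<in>C. u \<le> q"
    proof (cases "C = {}")
      case True
      then show ?thesis using p by (auto simp: A_def)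
    next
      case False
      define u where "u x = (INF q\<in>C. q x)" for x
      have sub: "sublinear q" "q x \<le> p x" if "q \<in> C" for q x
        using CA that by (auto simp: A_def le_fun_def)
      have bdd: "bdd_below ((\<lambda>q. q x) ` C)" for x
      proof (rule bdd_belowI2)
        fix q assume "q \<in> C"
        then show "- p (- x) \<le> q x"
          using sublinear_minus[OF sub(1), of q x] sub(2)[of q "- x"] by simp
      qed
      have lower: "u x \<le> q x" if "q \<in> C" for q x
        unfolding u_def using bdd that by (rule cINF_lower)
      have "u (x + y) \<le> u x + u y" for x y
      proof -
        have *: "u (x + y) \<le> q x + q' y" if qq: "q \<in> C" "q' \<in> C" for q q'
          using tot[OF qq]
        proof
          assume "q \<le> q'"
          then show ?thesis
            using lower[OF qq(1), of "x + y"] sublinear_add[OF sub(1)[OF qq(1)], of x y]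
              le_funD[of q q' y] by simp
        next
          assume "q' \<le> q"
          then show ?thesis
            using lower[OF qq(2), of "x + y"] sublinear_add[OF sub(1)[OF qq(2)], of x y]
              le_funD[of q' q x] by simp
        qed
        have "u (x + y) - q x \<le> u y" if "q \<in> C" for q
          unfolding u_def[of y] by (rule cINF_greatest) (use False *[OF that] in \<open>auto simp: algebra_simps\<close>)
        then have "u (x + y) - u y \<le> u x"
          unfolding u_def[of x] by (intro cINF_greatest) (use False in \<open>auto simp: algebra_simps\<close>)
        then show ?thesis by simp
      qed
      moreover have "u (r *\<^sub>R x) \<le> r * u x" if r: "0 \<le> r" for r x
      proof (cases "r = 0")
        case True
        obtain q where "q \<in> C" using False by blast
        then show ?thesis using lower[of q 0] sublinear_zero[OF sub(1), of q] True by simp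
      next
        case False': False
        have "u (r *\<^sub>R x) / r \<le> u x"
          unfolding u_def[of x]
        proof (rule cINF_greatest[OF False])
          fix q assume "q \<in> C"
          then show "u (r *\<^sub>R x) / r \<le> q x"
            using lower[of q "r *\<^sub>R x"] sublinear_scale[OF sub(1), of q r x] r False'
            by (simp add: field_simps)
        qed
        then show ?thesis using r False' by (simp add: field_simps)
      qed
      ultimately have "sublinear u" by (simp add: sublinear_def)
      moreover have "u \<le> p"
        using False lower sub(2) by (fastforce simp: le_fun_def intro: order_trans)
      ultimately show ?thesis using lower by (auto simp: A_def le_fun_def)
    qed
  qed
  then show thesis
    by (auto simp: A_def intro!: that intro: order_trans)
qed

text \<open>Minimality forces \<open>q = tilt q y\<close> for every \<open>y\<close>, and \<open>tilt q y x \<le> q (x + y) - q y\<close>.\<close>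

lemma minimal_sublinear_linear:
  assumes q: "sublinear q" and min: "\<And>q'. sublinear q' \<Longrightarrow> q' \<le> q \<Longrightarrow> q' = q"
  shows "linear q"
proof -
  have "tilt q y = q" for y
    using tilt_le[OF q, of 0 y] by (intro min sublinear_tilt q) (auto simp: le_fun_def)
  then have add: "q (x + y) = q x + q y" for x y
    using tilt_le[OF q, of 1 y x] sublinear_add[OF q, of x y] by simp
  then have neg: "q (- x) = - q x" for x
    using add[of x "- x"] sublinear_zero[OF q] by simp
  show ?thesis
  proof (rule linearI)
    fix r x
    show "q (r *\<^sub>R x) = r *\<^sub>R q x"
    proof (cases "0 \<le> r")
      case True
      then show ?thesis by (simp add: sublinear_scale[OF q])
    next
      case False
      then show ?thesis
        using sublinear_scale[OF q, of "- r" x] neg[of "r *\<^sub>R x"] by simp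
    qed
  qed (rule add)
qed

text \<open>The minimal functional is sought below \<open>tilt norm u\<close> rather than below
  \<open>norm\<close>: this is what forces it to attain \<open>norm u\<close> at
  \<open>u\<close>.\<close>

lemma exists_norming_functional:
  fixes u :: "'a::real_normed_vector"
  obtains f where "linear f" "f u = norm u" "\<And>x. \<bar>f x\<bar> \<le> norm x"
proof -
  let ?p = "tilt norm u"
  obtain q where q: "sublinear q" "q \<le> ?p" "\<And>q'. sublinear q' \<Longrightarrow> q' \<le> q \<Longrightarrow> q' = q"
    using exists_minimal_sublinear[OF sublinear_tilt[OF sublinear_norm]] by metis
  have lin: "linear q"
    using q by (intro minimal_sublinear_linear)
  have le: "q x \<le> norm x" for x
    using le_funD[OF q(2), of x] tilt_le[OF sublinear_norm, of 0 u x] by simp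
  have "q (- u) \<le> - norm u"
    using le_funD[OF q(2), of "- u"] tilt_le[OF sublinear_norm, of 1 u "- u"] by simp
  then have "q u = norm u"
    using le[of u] by (simp add: linear_neg[OF lin])
  moreover have "\<bar>q x\<bar> \<le> norm x" for x
    using le[of x] le[of "- x"] by (simp add: linear_neg[OF lin])
  ultimately show thesis using that lin by blast
qed

section \<open>Operators, embeddings and homotopies\<close>

context normed_space_over
begin

abbreviation "Op Y \<equiv> operators smul Y UNIV"
abbreviation "Em Y \<equiv> Emb smul Y UNIV"
abbreviation "htp Y \<equiv> homotopic_in_Emb smul Y UNIV"

text \<open>Functionals live on the whole space, so that one and the same functional can be
  restricted to every subspace in the chain of extensions.\<close>

definition bounded_functional :: "('a \<Rightarrow> 'k) \<Rightarrow> bool" where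
  "bounded_functional \<phi> \<longleftrightarrow> (\<forall>x y. \<phi> (x + y) = \<phi> x + \<phi> y) \<and> (\<forall>c x. \<phi> (smul c x) = c * \<phi> x) \<and>
     (\<exists>C. \<forall>x. norm (\<phi> x) \<le> C * norm x)"

lemma smul_scaleR: "smul c (r *\<^sub>R x) = r *\<^sub>R smul c x"
  by (metis smul_of_real scale_left_commute)

lemma subspace_scaleR: "subspace Y \<Longrightarrow> x \<in> Y \<Longrightarrow> r *\<^sub>R x \<in> Y"
  by (metis smul_of_real subspace_scale)

lemma bounded_functionalD:
  assumes "bounded_functional \<phi>"
  shows functional_add: "\<phi> (x + y) = \<phi> x + \<phi> y"
    and functional_smul: "\<phi> (smul c x) = c * \<phi> x"
    and functional_zero: "\<phi> 0 = 0"
    and functional_diff: "\<phi> (x - y) = \<phi> x - \<phi> y"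
    and functional_scaleR: "\<phi> (r *\<^sub>R x) = of_real r * \<phi> x"
proof -
  show add: "\<phi> (x + y) = \<phi> x + \<phi> y" and sc: "\<phi> (smul c x) = c * \<phi> x" for x y c
    using assms by (auto simp: bounded_functional_def)
  show "\<phi> 0 = 0" using sc[of 0 0] by simp
  show "\<phi> (x - y) = \<phi> x - \<phi> y" using add[of "x - y" y] by simp
  show "\<phi> (r *\<^sub>R x) = of_real r * \<phi> x" using sc[of "of_real r" x] by (simp add: smul_of_real)
qed

lemma functional_bounded:
  assumes "bounded_functional \<phi>"
  obtains C where "C > 0" "\<And>x. norm (\<phi> x) \<le> C * norm x"
proof -
  obtain C where C: "\<And>x. norm (\<phi> x) \<le> C * norm x"
    using assms by (auto simp: bounded_functional_def)
  have "norm (\<phi> x) \<le> (\<bar>C\<bar> + 1) * norm x" for x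
    by (rule order_trans[OF C[of x] mult_right_mono]) auto
  then show thesis using that[of "\<bar>C\<bar> + 1"] by simp
qed

lemma subspace_kernel: "subspace W \<Longrightarrow> bounded_functional \<phi> \<Longrightarrow> subspace {y \<in> W. \<phi> y = 0}"
  by (auto simp: subspace_def functional_add functional_smul functional_zero)

lemma restrict_in_OpI:
  assumes "subspace Y"
    and "\<And>x y. x \<in> Y \<Longrightarrow> y \<in> Y \<Longrightarrow> f (x + y) = f x + f y"
    and "\<And>c x. x \<in> Y \<Longrightarrow> f (smul c x) = smul c (f x)"
    and "\<And>x. x \<in> Y \<Longrightarrow> norm (f x) \<le> C * norm x"
  shows "restrict f Y \<in> Op Y"
  using assms by (auto simp: operators_def subspace_add subspace_scale intro!: exI[of _ C])

lemma OpD: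
  assumes "T \<in> Op Y"
  shows Op_add: "x \<in> Y \<Longrightarrow> y \<in> Y \<Longrightarrow> T (x + y) = T x + T y"
    and Op_smul: "x \<in> Y \<Longrightarrow> T (smul c x) = smul c (T x)"
    and Op_extensional: "T \<in> extensional Y"
  using assms by (auto simp: operators_def PiE_def)

lemma Op_diff: "T \<in> Op Y \<Longrightarrow> subspace Y \<Longrightarrow> x \<in> Y \<Longrightarrow> y \<in> Y \<Longrightarrow> T (x - y) = T x - T y"
  using Op_add[of T Y "x - y" y] by (simp add: subspace_diff)

lemma Op_scaleR: "T \<in> Op Y \<Longrightarrow> x \<in> Y \<Longrightarrow> T (r *\<^sub>R x) = r *\<^sub>R T x"
  by (metis Op_smul smul_of_real)

lemma Op_zero: "T \<in> Op Y \<Longrightarrow> subspace Y \<Longrightarrow> T 0 = 0"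
  using Op_diff[of T Y 0 0] by (simp add: subspace_0)

lemma Op_bounded:
  assumes "T \<in> Op Y"
  obtains C where "C > 0" "\<And>x. x \<in> Y \<Longrightarrow> norm (T x) \<le> C * norm x"
proof -
  obtain C where C: "\<And>x. x \<in> Y \<Longrightarrow> norm (T x) \<le> C * norm x"
    using assms unfolding operators_def by blast
  have "norm (T x) \<le> (\<bar>C\<bar> + 1) * norm x" if "x \<in> Y" for x
    by (rule order_trans[OF C[OF that] mult_right_mono]) auto
  then show thesis using that[of "\<bar>C\<bar> + 1"] by simp
qed

lemma Op_restrict:
  assumes T: "T \<in> Op Y" and "V \<subseteq> Y" "subspace V"
  shows "restrict T V \<in> Op V"
proof -
  obtain C where "\<And>x. x \<in> Y \<Longrightarrow> norm (T x) \<le> C * norm x"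
    using Op_bounded[OF T] by metis
  then show ?thesis
    using assms by (intro restrict_in_OpI[where C = C]) (auto simp: subset_iff Op_add[OF T] Op_smul[OF T])
qed

lemma Op_combination:
  assumes Y: "subspace Y" and S: "S \<in> Op Y" and T: "T \<in> Op Y"
  shows "(\<lambda>y\<in>Y. smul a (S y) + smul b (T y)) \<in> Op Y"
proof -
  obtain C where C: "\<And>x. x \<in> Y \<Longrightarrow> norm (S x) \<le> C * norm x"
    using Op_bounded[OF S] by metis
  obtain D where D: "\<And>x. x \<in> Y \<Longrightarrow> norm (T x) \<le> D * norm x"
    using Op_bounded[OF T] by metis
  show ?thesis
  proof (rule restrict_in_OpI[OF Y, where C = "norm a * C + norm b * D"])
    fix x assume x: "x \<in> Y"
    have "norm (smul a (S x) + smul b (T x)) \<le> norm a * norm (S x) + norm b * norm (T x)"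
      using norm_triangle_ineq[of "smul a (S x)" "smul b (T x)"] by (simp add: norm_smul)
    also have "\<dots> \<le> norm a * (C * norm x) + norm b * (D * norm x)"
      using C[OF x] D[OF x] by (intro add_mono mult_left_mono) auto
    finally show "norm (smul a (S x) + smul b (T x)) \<le> (norm a * C + norm b * D) * norm x"
      by (simp add: algebra_simps)
  qed (simp_all add: Op_add[OF S] Op_add[OF T] Op_smul[OF S] Op_smul[OF T] algebra_simps)
qed

lemma Op_combination_real:
  assumes "subspace Y" "S \<in> Op Y" "T \<in> Op Y"
  shows "(\<lambda>y\<in>Y. r *\<^sub>R S y + s *\<^sub>R T y) \<in> Op Y"
  using Op_combination[OF assms, of "of_real r" "of_real s"] by (simp add: smul_of_real)

lemma Op_rank_one:
  assumes "subspace Y" "bounded_functional \<phi>"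
  shows "(\<lambda>y\<in>Y. smul (\<phi> y) w) \<in> Op Y"
proof -
  obtain C where C: "\<And>x. norm (\<phi> x) \<le> C * norm x"
    using functional_bounded[OF assms(2)] by metis
  show ?thesis
  proof (rule restrict_in_OpI[OF assms(1), where C = "C * norm w"])
    show "norm (smul (\<phi> x) w) \<le> C * norm w * norm x" for x
      using mult_right_mono[OF C[of x], of "norm w"] by (simp add: norm_smul algebra_simps)
  qed (simp_all add: functional_add[OF assms(2)] functional_smul[OF assms(2)] algebra_simps)
qed

lemma Op_incl: "subspace Y \<Longrightarrow> incl Y \<in> Op Y"
  unfolding incl_def by (rule restrict_in_OpI[where C = 1]) auto

lemma EmI:
  assumes "T \<in> Op Y" "c > 0" "\<And>y. y \<in> Y \<Longrightarrow> c * norm y \<le> norm (T y)"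
  shows "T \<in> Em Y"
  using assms by (auto simp: Emb_def)

lemma EmI':
  assumes "T \<in> Op Y" "\<And>y. y \<in> Y \<Longrightarrow> norm y \<le> K * norm (T y)"
  shows "T \<in> Em Y"
proof (rule EmI[OF assms(1)])
  show "0 < 1 / (\<bar>K\<bar> + 1)" by simp
  fix y assume "y \<in> Y"
  then have "norm y \<le> (\<bar>K\<bar> + 1) * norm (T y)"
    by (intro order_trans[OF assms(2) mult_right_mono]) auto
  then show "1 / (\<bar>K\<bar> + 1) * norm y \<le> norm (T y)"
    by (simp add: field_simps)
qed

lemma Em_Op: "T \<in> Em Y \<Longrightarrow> T \<in> Op Y"
  by (simp add: Emb_def)

lemma Em_lower:
  assumes "T \<in> Em Y"
  obtains c where "c > 0" "\<And>y. y \<in> Y \<Longrightarrow> c * norm y \<le> norm (T y)"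
  using assms by (auto simp: Emb_def)

lemma Em_restrict: "T \<in> Em Y \<Longrightarrow> V \<subseteq> Y \<Longrightarrow> subspace V \<Longrightarrow> restrict T V \<in> Em V"
  by (rule Em_lower[of T Y], assumption, rule EmI) (auto intro: Op_restrict[OF Em_Op])

lemma Em_incl: "subspace Y \<Longrightarrow> incl Y \<in> Em Y"
  by (rule EmI[where c = 1]) (auto simp: Op_incl, auto simp: incl_def)

section \<open>The operator norm and elementary homotopies\<close>

lemma op_norm_le:
  assumes "subspace Y" "0 \<le> C" "\<And>y. y \<in> Y \<Longrightarrow> norm (f y) \<le> C * norm y"
  shows "op_norm Y f \<le> C"
proof -
  have le: "norm (f y) \<le> C" if "y \<in> {y \<in> Y. norm y \<le> 1}" for y
    using assms(3)[of y] that mult_left_mono[of "norm y" 1 C] assms(2) by auto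
  have "(SUP y\<in>{y \<in> Y. norm y \<le> 1}. norm (f y)) \<le> C"
    using subspace_0[OF assms(1)] by (intro cSUP_least le) (auto intro: exI[of _ 0])
  \<comment> \<open>The hypothesis \<open>0 \<le> C\<close> covers the default value 0 of
    \<open>op_norm\<close>.\<close>
  then show ?thesis using assms(2) by (simp add: op_norm_def)
qed

lemma norm_le_op_norm:
  assumes Y: "subspace Y" and S: "S \<in> Op Y" and T: "T \<in> Op Y" and y: "y \<in> Y"
  shows "norm (S y - T y) \<le> op_norm Y (\<lambda>y. S y - T y) * norm y"
proof (cases "y = 0")
  case True
  then show ?thesis by (simp add: Op_zero[OF S Y] Op_zero[OF T Y])
next
  case False
  let ?B = "{y \<in> Y. norm y \<le> 1}"
  let ?D = "\<lambda>y\<in>Y. smul 1 (S y) + smul (-1) (T y)"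
  obtain C where C: "C > 0" "\<And>x. x \<in> Y \<Longrightarrow> norm (S x - T x) \<le> C * norm x"
    using Op_bounded[OF Op_combination[OF Y S T, of 1 "-1"]] by auto
  have bdd: "bdd_above ((\<lambda>y. norm (S y - T y)) ` ?B)"
  proof (rule bdd_aboveI2)
    fix y assume "y \<in> ?B"
    then show "norm (S y - T y) \<le> C"
      using order_trans[OF C(2)[of y] mult_left_mono[of "norm y" 1 C]] C(1) by auto
  qed
  let ?y = "(1 / norm y) *\<^sub>R y"
  have "?y \<in> ?B"
    using False subspace_scaleR[OF Y y] by simp
  from cSUP_upper[OF this bdd] have "norm (S ?y - T ?y) \<le> op_norm Y (\<lambda>y. S y - T y)"
    using bdd by (simp add: op_norm_def)
  also have "S ?y - T ?y = (1 / norm y) *\<^sub>R (S y - T y)"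
    using y by (simp only: Op_scaleR[OF S] Op_scaleR[OF T] scaleR_diff_right)
  finally show ?thesis using False by (simp add: divide_le_eq)
qed

lemma htp_refl: "subspace Y \<Longrightarrow> T \<in> Em Y \<Longrightarrow> htp Y T T"
  using Metric_space.topspace_mtopology[OF Metric_space_Emb[of Y UNIV]]
  by (simp add: homotopic_in_Emb_def Emb_topology_def path_component_of_refl)

lemma htp_sym: "htp Y S T \<Longrightarrow> htp Y T S"
  by (simp add: homotopic_in_Emb_def path_component_of_sym)

lemma htp_trans [trans]: "htp Y S T \<Longrightarrow> htp Y T U \<Longrightarrow> htp Y S U"
  unfolding homotopic_in_Emb_def by (rule path_component_of_trans)

text \<open>The segment is Lipschitz in \<open>s\<close>, with a bound for \<open>S - T\<close> as
  constant, so a homotopy only requires every point of it to be bounded below.\<close>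

lemma htp_segment:
  assumes Y: "subspace Y" and S: "S \<in> Op Y" and T: "T \<in> Op Y"
    and seg: "\<And>s. 0 \<le> s \<Longrightarrow> s \<le> 1 \<Longrightarrow> (\<lambda>y\<in>Y. (1 - s) *\<^sub>R S y + s *\<^sub>R T y) \<in> Em Y"
  shows "htp Y S T"
proof -
  interpret M: Metric_space "Em Y" "\<lambda>S T. op_norm Y (\<lambda>y. S y - T y)"
    by (rule Metric_space_Emb[OF Y])
  define g where "g s = (\<lambda>y\<in>Y. (1 - s) *\<^sub>R S y + s *\<^sub>R T y)" for s
  have g: "g s \<in> Em Y" if "0 \<le> s" "s \<le> 1" for s
    unfolding g_def by (rule seg[OF that])
  obtain C where C: "C > 0" "\<And>x. x \<in> Y \<Longrightarrow> norm (S x - T x) \<le> C * norm x"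
    using Op_bounded[OF Op_combination[OF Y S T, of 1 "-1"]] by auto
  have dist: "op_norm Y (\<lambda>y. g s y - g t y) \<le> \<bar>s - t\<bar> * C" for s t
  proof (rule op_norm_le[OF Y])
    fix y assume y: "y \<in> Y"
    have "g s y - g t y = (t - s) *\<^sub>R (S y - T y)"
      using y by (simp add: g_def algebra_simps)
    then show "norm (g s y - g t y) \<le> \<bar>s - t\<bar> * C * norm y"
      using mult_left_mono[OF C(2)[OF y], of "\<bar>s - t\<bar>"] by (simp add: abs_minus_commute)
  qed (use C in auto)
  have "pathin M.mtopology g"
    unfolding pathin_def continuous_map_def
  proof (intro conjI allI impI)
    show "g \<in> topspace (top_of_set {0..1}) \<rightarrow> topspace M.mtopology"
      using g by auto
    fix U assume U: "openin M.mtopology U"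
    show "openin (top_of_set {0..1}) {x \<in> topspace (top_of_set {0..1}). g x \<in> U}"
      unfolding openin_euclidean_subtopology_iff
    proof (intro conjI ballI)
      fix s assume s: "s \<in> {x \<in> topspace (top_of_set {0..1}). g x \<in> U}"
      then obtain r where r: "r > 0" "M.mball (g s) r \<subseteq> U"
        using U by (auto simp: M.openin_mtopology)
      have "g t \<in> U" if t: "t \<in> {0..1}" "dist t s < r / C" for t
      proof -
        have "\<bar>s - t\<bar> * C < r"
          using t(2) C(1) by (simp add: dist_real_def abs_minus_commute pos_less_divide_eq)
        then have "g t \<in> M.mball (g s) r"
          using dist[of s t] s t g by auto
        then show ?thesis using r by blast
      qed
      then show "\<exists>e>0. \<forall>x'\<in>{0..1}. dist x' s < e \<longrightarrow> x' \<in> {x \<in> topspace (top_of_set {0..1}). g x \<in> U}"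
        using r(1) C(1) by (intro exI[of _ "r / C"]) auto
    qed auto
  qed
  moreover have "g 0 = S" "g 1 = T"
    by (rule extensionalityI[of _ Y]; simp add: g_def Op_extensional[OF S] Op_extensional[OF T])+
  ultimately show ?thesis
    unfolding homotopic_in_Emb_def Emb_topology_def path_component_of_def by blast
qed

text \<open>The error is measured against \<open>norm (L y)\<close> and not against
  \<open>norm y\<close>, so no lower bound of \<open>L\<close> enters the tolerance.
  \<open>extend_nearby\<close> depends on this, since it has no uniform lower bound on the larger
  space.\<close>

lemma htp_near:
  assumes Y: "subspace Y" and L: "L \<in> Em Y" and D: "D \<in> Op Y"
    and near: "\<And>y. y \<in> Y \<Longrightarrow> norm (D y - L y) \<le> norm (L y) / 2"
  shows "D \<in> Em Y" "htp Y L D"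
proof -
  obtain c where c: "c > 0" "\<And>y. y \<in> Y \<Longrightarrow> c * norm y \<le> norm (L y)"
    using Em_lower[OF L] by metis
  have seg: "(\<lambda>y\<in>Y. (1 - s) *\<^sub>R L y + s *\<^sub>R D y) \<in> Em Y" if s: "0 \<le> s" "s \<le> 1" for s
  proof (rule EmI)
    show "(\<lambda>y\<in>Y. (1 - s) *\<^sub>R L y + s *\<^sub>R D y) \<in> Op Y"
      using Op_combination_real[OF Y Em_Op[OF L] D] .
    show "0 < c / 2" using c by simp
    fix y assume y: "y \<in> Y"
    have "norm (s *\<^sub>R (D y - L y)) \<le> 1 * (norm (L y) / 2)"
      unfolding norm_scaleR using s near[OF y] by (intro mult_mono) auto
    moreover have "(1 - s) *\<^sub>R L y + s *\<^sub>R D y = L y + s *\<^sub>R (D y - L y)"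
      by (simp add: algebra_simps)
    ultimately have "norm (L y) / 2 \<le> norm ((1 - s) *\<^sub>R L y + s *\<^sub>R D y)"
      using norm_triangle_ineq4[of "L y + s *\<^sub>R (D y - L y)" "s *\<^sub>R (D y - L y)"] by simp
    then show "c / 2 * norm y \<le> norm ((\<lambda>y\<in>Y. (1 - s) *\<^sub>R L y + s *\<^sub>R D y) y)"
      using c(2)[OF y] y by simp
  qed
  show "htp Y L D" by (rule htp_segment[OF Y Em_Op[OF L] D seg])
  have "(\<lambda>y\<in>Y. (1 - 1) *\<^sub>R L y + 1 *\<^sub>R D y) = D"
    by (rule extensionalityI[of _ Y]) (simp_all add: Op_extensional[OF D])
  then show "D \<in> Em Y" using seg[of 1] by simp
qed

lemma Em_uminus:
  assumes "subspace Y" "T \<in> Em Y" shows "(\<lambda>y\<in>Y. - T y) \<in> Em Y"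
proof (rule Em_lower[OF assms(2)], rule EmI)
  show "(\<lambda>y\<in>Y. - T y) \<in> Op Y"
    using Op_combination[OF assms(1) Em_Op[OF assms(2)] Em_Op[OF assms(2)], of "-1" 0] by simp
qed auto

lemma htp_uminus:
  assumes Y: "subspace Y" and ST: "htp Y S T"
  shows "htp Y (\<lambda>y\<in>Y. - S y) (\<lambda>y\<in>Y. - T y)"
proof -
  interpret M: Metric_space "Em Y" "\<lambda>S T. op_norm Y (\<lambda>y. S y - T y)"
    by (rule Metric_space_Emb[OF Y])
  define n where "n S = (\<lambda>y\<in>Y. - S y)" for S :: "'a \<Rightarrow> 'a"
  have n: "n S \<in> Em Y" if "S \<in> Em Y" for S
    using Em_uminus[OF Y that] by (simp add: n_def)
  have im: "(\<lambda>y. norm (n S y - n T y)) ` {y \<in> Y. norm y \<le> 1} = (\<lambda>y. norm (S y - T y)) ` {y \<in> Y. norm y \<le> 1}" for S T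
    by (rule image_cong) (auto simp: n_def norm_minus_commute)
  have iso: "op_norm Y (\<lambda>y. n S y - n T y) = op_norm Y (\<lambda>y. S y - T y)" for S T
    unfolding op_norm_def im ..
  have "continuous_map M.mtopology M.mtopology n"
    using n iso by (auto simp: M.metric_continuous_map[OF M.Metric_space_axioms])
  from path_component_of_continuous_image[OF this] ST show ?thesis
    by (simp add: homotopic_in_Emb_def Emb_topology_def n_def)
qed

end

section \<open>Extending homotopies by one dimension\<close>

context normed_space_over
begin

text \<open>The new operator is \<open>B\<close> after the shear sending \<open>y\<close> to
  \<open>y - smul (\<phi> y) v\<close>. As \<open>\<phi> v = 0\<close>, the shear preserves
  \<open>\<phi>\<close> and is inverted by changing the sign of \<open>v\<close>; scaling
  \<open>v\<close> by \<open>s\<close> joins it to the identity through invertible shears.\<close>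

lemma htp_shear:
  assumes W: "subspace W" and \<phi>: "bounded_functional \<phi>" and B: "B \<in> Em W"
    and v: "v \<in> W" "\<phi> v = 0"
  shows "(\<lambda>y\<in>W. B y - smul (\<phi> y) (B v)) \<in> Em W"
    and "htp W B (\<lambda>y\<in>W. B y - smul (\<phi> y) (B v))"
proof -
  let ?L = "\<lambda>y\<in>W. B y - smul (\<phi> y) (B v)"
  note BO = Em_Op[OF B]
  obtain c where c: "c > 0" "\<And>y. y \<in> W \<Longrightarrow> c * norm y \<le> norm (B y)"
    using Em_lower[OF B] by metis
  obtain C where C: "C > 0" "\<And>x. norm (\<phi> x) \<le> C * norm x"
    using functional_bounded[OF \<phi>] by metis
  have L: "?L \<in> Op W"
    using Op_combination[OF W BO Op_rank_one[OF W \<phi>, of "B v"], of 1 "- 1"]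
    by (simp cong: restrict_cong)
  have seg: "(\<lambda>y\<in>W. (1 - s) *\<^sub>R B y + s *\<^sub>R ?L y) \<in> Em W" if s: "0 \<le> s" "s \<le> 1" for s
  proof (rule EmI')
    show "(\<lambda>y\<in>W. (1 - s) *\<^sub>R B y + s *\<^sub>R ?L y) \<in> Op W"
      by (rule Op_combination_real[OF W BO L])
    fix y assume y: "y \<in> W"
    define y' where "y' = y - smul (of_real s * \<phi> y) v"
    have y': "y' \<in> W" "\<phi> y' = \<phi> y"
      using y v by (simp_all add: y'_def W subspace_diff subspace_scale functional_diff[OF \<phi>] functional_smul[OF \<phi>])
    have "B y' = B y - smul (of_real s * \<phi> y) (B v)"
      using y v by (simp add: y'_def Op_diff[OF BO W] Op_smul[OF BO] W subspace_scale)
    also have "smul (of_real s * \<phi> y) (B v) = s *\<^sub>R smul (\<phi> y) (B v)"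
      by (metis scale_scale smul_of_real)
    finally have eq: "(1 - s) *\<^sub>R B y + s *\<^sub>R ?L y = B y'"
      using y by (simp add: algebra_simps)
    have "norm (smul (of_real s * \<phi> y') v) \<le> 1 * (C * norm y') * norm v"
      using s C(2)[of y'] unfolding norm_smul norm_mult by (intro mult_right_mono mult_mono) auto
    moreover have "norm y \<le> norm y' + norm (smul (of_real s * \<phi> y') v)"
      using norm_triangle_ineq[of y' "smul (of_real s * \<phi> y') v"] by (simp add: y'(2)) (simp add: y'_def)
    ultimately have "norm y \<le> (1 + C * norm v) * norm y'"
      by (simp add: algebra_simps)
    also have "\<dots> \<le> (1 + C * norm v) * (norm (B y') / c)"
      using c(1) c(2)[OF y'(1)] C(1) by (intro mult_left_mono) (auto simp: field_simps)
    finally show "norm y \<le> (1 + C * norm v) / c * norm ((\<lambda>y\<in>W. (1 - s) *\<^sub>R B y + s *\<^sub>R ?L y) y)"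
      using y eq by simp
  qed
  show "htp W B ?L" by (rule htp_segment[OF W BO L seg])
  show "?L \<in> Em W"
    using seg[of 1] by (simp cong: restrict_cong)
qed

text \<open>Shearing first moves the value at \<open>x\<close> to \<open>B x - B v\<close>, almost the shortest vector of its
  coset. Then the components of \<open>L y\<close> are controlled by \<open>L y\<close> with constants that depend only on the
  lower bound of \<open>B\<close> on the kernel, so that the radius of the admissible perturbations does not
  depend on the extension.\<close>

lemma extend_nearby:
  assumes W: "subspace W" and \<phi>: "bounded_functional \<phi>" and x: "x \<in> W" "\<phi> x = 1"
    and V: "V = {y \<in> W. \<phi> y = 0}" and B: "B \<in> Em W" and C: "C \<in> Em V"
    and c: "c > 0" "\<And>v. v \<in> V \<Longrightarrow> c * norm v \<le> norm (B v)"
    and near: "\<And>v. v \<in> V \<Longrightarrow> norm (C v - B v) \<le> c / 6 * norm v"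
  obtains C' where "C' \<in> Em W" "restrict C' V = C" "htp W B C'"
proof -
  note BO = Em_Op[OF B] and CO = Em_Op[OF C]
  have Vs: "subspace V" unfolding V by (rule subspace_kernel[OF W \<phi>])
  have VW: "v \<in> W" "\<phi> v = 0" if "v \<in> V" for v using that V by auto
  obtain b where b: "b > 0" "\<And>y. y \<in> W \<Longrightarrow> b * norm y \<le> norm (B y)"
    using Em_lower[OF B] by metis
  obtain K where K: "K > 0" "\<And>x. norm (\<phi> x) \<le> K * norm x"
    using functional_bounded[OF \<phi>] by metis
  have away: "b / K \<le> norm (B x - B v)" if v: "v \<in> V" for v
  proof -
    have "1 \<le> K * norm (x - v)"
      using K(2)[of "x - v"] x VW[OF v] by (simp add: functional_diff[OF \<phi>])
    also have "norm (x - v) \<le> norm (B (x - v)) / b"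
      using b(1) b(2)[of "x - v"] x VW[OF v] W by (simp add: subspace_diff field_simps)
    finally show ?thesis
      using K(1) b(1) x VW[OF v] by (simp add: Op_diff[OF BO W] field_simps)
  qed
  \<comment> \<open>The distance from \<open>B x\<close> to the image of \<open>V\<close>, positive
    by \<open>away\<close>. It need not be attained, so \<open>v0\<close> is chosen within a factor
    2 of it.\<close>
  define d where "d = (INF v\<in>V. norm (B x - B v))"
  have "V \<noteq> {}" using subspace_0[OF Vs] by blast
  then have "b / K \<le> d" unfolding d_def by (intro cINF_greatest away) auto
  then have d: "d > 0" using b(1) K(1) by (meson divide_pos_pos less_le_trans)
  have d_le: "d \<le> norm (B x - B v)" if "v \<in> V" for v
    unfolding d_def using that by (intro cINF_lower bdd_belowI2[where m = 0]) auto
  have "\<exists>v\<in>V. norm (B x - B v) < 2 * d"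
  proof (rule ccontr)
    assume "\<not> ?thesis"
    then have "2 * d \<le> d" unfolding d_def[symmetric]
      using \<open>V \<noteq> {}\<close> by (subst (2) d_def) (auto intro!: cINF_greatest simp: not_less)
    then show False using d by simp
  qed
  then obtain v0 where v0: "v0 \<in> V" "norm (B x - B v0) < 2 * d" by blast
  let ?L = "\<lambda>y\<in>W. B y - smul (\<phi> y) (B v0)"
  note L = htp_shear[OF W \<phi> B VW[OF v0(1)]]
  define pr where "pr y = y - smul (\<phi> y) x" for y
  have pr: "pr y \<in> V" if "y \<in> W" for y
    using that x by (simp add: pr_def V W subspace_diff subspace_scale functional_diff[OF \<phi>] functional_smul[OF \<phi>])
  have pr_V: "pr v = v" if "v \<in> V" for v
    using VW[OF that] by (simp add: pr_def)
  have L_decomp: "?L y = B (pr y) + smul (\<phi> y) (B x - B v0)" if y: "y \<in> W" for y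
    using y x by (simp add: pr_def Op_diff[OF BO W] Op_smul[OF BO] W subspace_scale algebra_simps)
  \<comment> \<open>If \<open>\<phi> y\<close> is nonzero, \<open>?L y\<close> is
    \<open>\<phi> y\<close> times a vector \<open>B x - B ?v\<close> with \<open>?v\<close> in
    \<open>V\<close>, of norm at least \<open>d\<close>; and \<open>B x - B v0\<close> is shorter
    than \<open>2 * d\<close>.\<close>
  have coeff: "norm (smul (\<phi> y) (B x - B v0)) \<le> 2 * norm (?L y)" if y: "y \<in> W" for y
  proof (cases "\<phi> y = 0")
    case False
    let ?v = "v0 - smul (1 / \<phi> y) (pr y)"
    have v: "?v \<in> V" using v0(1) pr[OF y] Vs by (simp add: subspace_diff subspace_scale)
    have Bv: "B ?v = B v0 - smul (1 / \<phi> y) (B (pr y))"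
      using VW[OF v0(1)] VW[OF pr[OF y]] W by (simp add: Op_diff[OF BO W] Op_smul[OF BO] subspace_scale)
    have "?L y = smul (\<phi> y) (B x - B ?v)"
      unfolding L_decomp[OF y] Bv using False by (simp add: algebra_simps)
    then have "norm (?L y) = norm (\<phi> y) * norm (B x - B ?v)" by (simp only: norm_smul)
    moreover have "norm (\<phi> y) * norm (B x - B v0) \<le> norm (\<phi> y) * (2 * norm (B x - B ?v))"
      using d_le[OF v] v0(2) by (intro mult_left_mono) auto
    ultimately show ?thesis by (simp add: norm_smul)
  qed simp
  \<comment> \<open>The factor 3 is 1 + 2, the 2 coming from \<open>coeff\<close>. With the radius
    \<open>c / 6\<close> of \<open>near\<close> the error is at most 3/6 of
    \<open>norm (?L y)\<close>, exactly the tolerance of \<open>htp_near\<close>.\<close>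
  have base: "c * norm (pr y) \<le> 3 * norm (?L y)" if y: "y \<in> W" for y
  proof -
    have "B (pr y) = ?L y - smul (\<phi> y) (B x - B v0)"
      unfolding L_decomp[OF y] by simp
    then have "norm (B (pr y)) \<le> norm (?L y) + norm (smul (\<phi> y) (B x - B v0))"
      by (metis norm_triangle_ineq4)
    then show ?thesis using coeff[OF y] c(2)[OF pr[OF y]] by linarith
  qed
  \<comment> \<open>Equal to \<open>?L\<close> at \<open>x\<close> and to \<open>C\<close> on
    \<open>V\<close>, so that the two differ only through the component in \<open>V\<close>.\<close>
  define C' where "C' = (\<lambda>y\<in>W. C (pr y) + smul (\<phi> y) (B x - B v0))"
  have C'_L: "C' y - ?L y = C (pr y) - B (pr y)" if y: "y \<in> W" for y
    using y unfolding L_decomp[OF y] by (simp add: C'_def)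
  have "C' \<in> Op W"
  proof -
    obtain M where M: "M > 0" "\<And>v. v \<in> V \<Longrightarrow> norm (C v) \<le> M * norm v"
      using Op_bounded[OF CO] by metis
    have pr_add: "pr (y + z) = pr y + pr z" and pr_smul: "pr (smul a y) = smul a (pr y)" for y z a
      by (simp_all add: pr_def functional_add[OF \<phi>] functional_smul[OF \<phi>] algebra_simps)
    have "(\<lambda>y\<in>W. C (pr y)) \<in> Op W"
    proof (rule restrict_in_OpI[OF W, where C = "M * (1 + K * norm x)"])
      fix y assume y: "y \<in> W"
      have "norm (pr y) \<le> norm y + norm (\<phi> y) * norm x"
        using norm_triangle_ineq4[of y "smul (\<phi> y) x"] by (simp add: pr_def norm_smul)
      also have "\<dots> \<le> (1 + K * norm x) * norm y"
        using mult_right_mono[OF K(2)[of y], of "norm x"] by (simp add: algebra_simps)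
      finally have "M * norm (pr y) \<le> M * ((1 + K * norm x) * norm y)"
        using M(1) by simp
      then show "norm (C (pr y)) \<le> M * (1 + K * norm x) * norm y"
        using M(2)[OF pr[OF y]] by (simp add: mult.assoc)
    qed (simp_all add: pr_add pr_smul pr Op_add[OF CO] Op_smul[OF CO])
    from Op_combination[OF W this Op_rank_one[OF W \<phi>, of "B x - B v0"], of 1 1]
    show ?thesis by (simp add: C'_def cong: restrict_cong)
  qed
  moreover have "norm (C' y - ?L y) \<le> norm (?L y) / 2" if y: "y \<in> W" for y
    using near[OF pr[OF y]] base[OF y] unfolding C'_L[OF y] by simp
  ultimately have C': "C' \<in> Em W" "htp W ?L C'"
    using htp_near[OF W L(1)] by blast+
  moreover have "restrict C' V = C"
    by (rule extensionalityI[OF restrict_extensional Op_extensional[OF CO]]) (simp add: C'_def VW pr_V)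
  ultimately show thesis
    using that htp_trans[OF L(2)] by blast
qed

text \<open>The set \<open>P\<close> of embeddings of \<open>V\<close> that extend to an embedding
  of \<open>W\<close> homotopic to \<open>S\<close> is open and closed in \<open>Em V\<close>. It
  contains the start of the given path, hence by connectedness also its end.\<close>

lemma homotopy_extension:
  assumes W: "subspace W" and \<phi>: "bounded_functional \<phi>" and x: "x \<in> W" "\<phi> x = 1"
    and V: "V = {y \<in> W. \<phi> y = 0}" and S: "S \<in> Em W" and SC: "htp V (restrict S V) C"
  obtains C' where "C' \<in> Em W" "restrict C' V = C" "htp W S C'"
proof -
  have Vs: "subspace V" unfolding V by (rule subspace_kernel[OF W \<phi>])
  have VW: "V \<subseteq> W" by (auto simp: V)
  interpret M: Metric_space "Em V" "\<lambda>S T. op_norm V (\<lambda>y. S y - T y)"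
    by (rule Metric_space_Emb[OF Vs])
  define P where "P = {B \<in> Em V. \<exists>B'\<in>Em W. restrict B' V = B \<and> htp W S B'}"
  have step: "D \<in> P"
    if B: "B \<in> P" and D: "D \<in> Em V" and c: "c > 0" "\<And>v. v \<in> V \<Longrightarrow> c * norm v \<le> norm (B v)"
      and near: "op_norm V (\<lambda>y. D y - B y) \<le> c / 6" for B D c
  proof -
    obtain B' where B': "B' \<in> Em W" "restrict B' V = B" "htp W S B'" and BE: "B \<in> Em V"
      using B by (auto simp: P_def)
    have eq: "B' v = B v" if "v \<in> V" for v using B'(2) that by auto
    have "norm (D v - B' v) \<le> c / 6 * norm v" if v: "v \<in> V" for v
      using norm_le_op_norm[OF Vs Em_Op[OF D] Em_Op[OF BE] v] mult_right_mono[OF near, of "norm v"]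
      by (simp add: eq[OF v])
    then obtain D' where "D' \<in> Em W" "restrict D' V = D" "htp W B' D'"
      using extend_nearby[OF W \<phi> x V B'(1) D c(1)] c(2) eq by metis
    then show ?thesis using D htp_trans[OF B'(3)] by (auto simp: P_def)
  qed
  have openP: "openin M.mtopology P"
    unfolding M.openin_mtopology
  proof (intro conjI allI impI)
    show "P \<subseteq> Em V" by (auto simp: P_def)
    fix B assume B: "B \<in> P"
    then obtain c where c: "c > 0" "\<And>v. v \<in> V \<Longrightarrow> c * norm v \<le> norm (B v)"
      using Em_lower[of B V] by (auto simp: P_def)
    have "D \<in> P" if "D \<in> M.mball B (c / 6)" for D
      using step[OF B _ c, of D] that M.commute[of B D] by simp
    then show "\<exists>r>0. M.mball B r \<subseteq> P" using c(1) by (intro exI[of _ "c / 6"]) auto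
  qed
  have openP': "openin M.mtopology (Em V - P)"
    unfolding M.openin_mtopology
  proof (intro conjI allI impI)
    fix B assume B: "B \<in> Em V - P"
    then obtain c where c: "c > 0" "\<And>v. v \<in> V \<Longrightarrow> c * norm v \<le> norm (B v)"
      using Em_lower[of B V] by auto
    \<comment> \<open>Near \<open>B\<close> the lower bound of \<open>D\<close> is still
      \<open>c / 2\<close>, whatever extension \<open>D\<close> has. The admissible radius around
      \<open>D\<close> is therefore \<open>(c / 2) / 6 = c / 12\<close>, and \<open>B\<close> would
      be reached from \<open>D\<close>.\<close>
    have "D \<notin> P" if D: "D \<in> M.mball B (c / 12)" for D
    proof
      assume P: "D \<in> P"
      have BD: "op_norm V (\<lambda>y. B y - D y) \<le> c / 12" and DE: "D \<in> Em V"
        using D by auto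
      have "c / 2 * norm v \<le> norm (D v)" if v: "v \<in> V" for v
      proof -
        have "norm (B v - D v) \<le> c / 12 * norm v"
          using norm_le_op_norm[OF Vs, of B D v] B DE v mult_right_mono[OF BD, of "norm v"]
          by (simp add: Em_Op)
        moreover have "norm (B v) \<le> norm (B v - D v) + norm (D v)"
          using norm_triangle_ineq[of "B v - D v" "D v"] by simp
        moreover have "0 \<le> c * norm v" using c(1) by simp
        ultimately show ?thesis using c(2)[OF v] by (simp add: field_simps)
      qed
      then have "B \<in> P"
        using step[OF P, of B "c / 2"] B c(1) BD by auto
      then show False using B by blast
    qed
    then show "\<exists>r>0. M.mball B r \<subseteq> Em V - P"
      using c(1) by (intro exI[of _ "c / 12"]) (auto simp: M.mball_subset_mspace)
  qed auto
  obtain g where g: "pathin M.mtopology g" "g 0 = restrict S V" "g 1 = C"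
    using SC by (auto simp: homotopic_in_Emb_def Emb_topology_def path_component_of_def)
  have conn: "connectedin M.mtopology (g ` {0..1})"
    by (rule connectedin_path_image[OF g(1)])
  have "restrict S V \<in> P"
    using S Em_restrict[OF S VW Vs] htp_refl[OF W S] by (auto simp: P_def)
  then have "P \<inter> g ` {0..1} \<noteq> {}" using g(2) by force
  moreover have "g ` {0..1} \<subseteq> Em V"
    using connectedin_subset_topspace[OF conn] by simp
  ultimately have "(Em V - P) \<inter> g ` {0..1} = {}"
    using connectedinD[OF conn openP openP'] by blast
  then have "C \<in> P"
    using g(3) \<open>g ` {0..1} \<subseteq> Em V\<close> by force
  then show thesis using that by (auto simp: P_def)
qed

end

section \<open>Extending homotopies to the inclusion over finite codimension\<close>

context normed_space_over
begin

lemma closed_kernel: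
  assumes "closed W" "bounded_functional \<phi>"
  shows "closed {y \<in> W. \<phi> y = 0}"
proof -
  obtain K where K: "K > 0" "\<And>x. norm (\<phi> x) \<le> K * norm x"
    using functional_bounded[OF assms(2)] by metis
  have "bounded_linear \<phi>"
    by (rule bounded_linear_intro[where K = K])
      (use K in \<open>auto simp: functional_add[OF assms(2)] functional_scaleR[OF assms(2)] scaleR_conv_of_real mult.commute\<close>)
  then have "closed {y. \<phi> y = 0}"
    by (intro closed_Collect_eq linear_continuous_on continuous_on_const)
  then show ?thesis
    using closed_Int[OF assms(1)] by (simp add: Collect_conj_eq)
qed

lemma common_kernel:
  assumes "subspace Y" and \<Phi>: "\<And>\<phi>. \<phi> \<in> \<Phi> \<Longrightarrow> bounded_functional \<phi>"
  shows "subspace {y \<in> Y. \<forall>\<phi>\<in>\<Phi>. \<phi> y = 0}"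
    and "closed Y \<Longrightarrow> closed {y \<in> Y. \<forall>\<phi>\<in>\<Phi>. \<phi> y = 0}"
proof -
  show "subspace {y \<in> Y. \<forall>\<phi>\<in>\<Phi>. \<phi> y = 0}"
    using assms by (auto simp: subspace_def functional_add functional_smul functional_zero)
  assume "closed Y"
  moreover have "closed (\<Inter>\<phi>\<in>\<Phi>. {y \<in> UNIV. \<phi> y = 0})"
    using \<Phi> by (intro closed_INT ballI closed_kernel) auto
  moreover have "{y \<in> Y. \<forall>\<phi>\<in>\<Phi>. \<phi> y = 0} = Y \<inter> (\<Inter>\<phi>\<in>\<Phi>. {y \<in> UNIV. \<phi> y = 0})"
    by auto
  ultimately show "closed {y \<in> Y. \<forall>\<phi>\<in>\<Phi>. \<phi> y = 0}" by (simp add: closed_Int)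
qed

text \<open>Used with \<open>\<phi> x = 1\<close>. For \<open>v = w - x\<close> it is the operator
  that fixes the kernel of \<open>\<phi>\<close> in \<open>W\<close> and sends \<open>x\<close> to
  \<open>w\<close>; for \<open>v = - 2 *\<^sub>R x\<close> it is the reflection that sends
  \<open>x\<close> to \<open>- x\<close>.\<close>

definition rank_one_shift :: "'a set \<Rightarrow> ('a \<Rightarrow> 'k) \<Rightarrow> 'a \<Rightarrow> 'a \<Rightarrow> 'a" where
  "rank_one_shift W \<phi> v = (\<lambda>y\<in>W. y + smul (\<phi> y) v)"

lemma rank_one_shift_Op:
  assumes "subspace W" "bounded_functional \<phi>"
  shows "rank_one_shift W \<phi> v \<in> Op W"
  using Op_combination[OF assms(1) Op_incl[OF assms(1)] Op_rank_one[OF assms, of v], of 1 1]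
  by (simp add: rank_one_shift_def incl_def cong: restrict_cong)

text \<open>The kernel in \<open>W\<close> is closed, so \<open>w\<close>, which may also lie
  outside \<open>W\<close>, has a positive distance \<open>d\<close> from it. This bounds the
  coefficient \<open>\<phi> y\<close> by the norm of the image, and then the component of
  \<open>y\<close> in the kernel.\<close>

lemma rank_one_shift_Em:
  assumes W: "subspace W" "closed W" and \<phi>: "bounded_functional \<phi>" and x: "x \<in> W" "\<phi> x = 1"
    and w: "\<not> (w \<in> W \<and> \<phi> w = 0)"
  shows "rank_one_shift W \<phi> (w - x) \<in> Em W"
proof -
  let ?V = "{y \<in> W. \<phi> y = 0}"
  have V: "subspace ?V" "closed ?V"
    using subspace_kernel closed_kernel W \<phi> by auto
  obtain d where d: "d > 0" "ball w d \<subseteq> - ?V"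
    using V(2) w openE[of "- ?V" w] by (auto simp: open_Compl)
  have away: "d \<le> norm (w - v)" if "v \<in> ?V" for v
    using d(2) that by (force simp: dist_norm)
  show ?thesis
  proof (rule EmI'[OF rank_one_shift_Op[OF W(1) \<phi>]])
    fix y assume y: "y \<in> W"
    define p where "p = y - smul (\<phi> y) x"
    define L where "L = p + smul (\<phi> y) w"
    have p: "p \<in> ?V"
      using y x by (simp add: p_def W subspace_diff subspace_scale functional_diff[OF \<phi>] functional_smul[OF \<phi>])
    have L: "rank_one_shift W \<phi> (w - x) y = L"
      using y by (simp add: rank_one_shift_def L_def p_def algebra_simps)
    have coeff: "norm (\<phi> y) * d \<le> norm L"
    proof (cases "\<phi> y = 0")
      case False
      let ?v = "smul (- (1 / \<phi> y)) p"
      have v: "?v \<in> ?V" using p V(1) subspace_scale by blast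
      have "L = smul (\<phi> y) (w - ?v)"
        unfolding L_def using False by (simp add: algebra_simps)
      then have "norm L = norm (\<phi> y) * norm (w - ?v)" by (simp only: norm_smul)
      then show ?thesis using away[OF v] by (simp add: mult_left_mono)
    qed simp
    have "norm p \<le> norm L + norm (\<phi> y) * norm w"
      using norm_triangle_ineq4[of L "smul (\<phi> y) w"] by (simp add: L_def norm_smul)
    moreover have "norm y \<le> norm p + norm (\<phi> y) * norm x"
      using norm_triangle_ineq[of p "smul (\<phi> y) x"] by (simp add: p_def norm_smul)
    moreover have "norm (\<phi> y) * (norm w + norm x) \<le> norm L / d * (norm w + norm x)"
      using coeff d(1) by (intro mult_right_mono) (auto simp: field_simps)
    ultimately have "norm y \<le> norm L + norm L / d * (norm w + norm x)"
      by (simp add: algebra_simps)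
    then show "norm y \<le> (1 + (norm w + norm x) / d) * norm (rank_one_shift W \<phi> (w - x) y)"
      unfolding L by (simp add: algebra_simps add_divide_distrib)
  qed
qed

text \<open>The operator is affine in the value \<open>w\<close> at \<open>x\<close>, so a segment
  of values that avoids the kernel is a segment of embeddings.\<close>

lemma rank_one_shift_htp:
  assumes W: "subspace W" "closed W" and \<phi>: "bounded_functional \<phi>" and x: "x \<in> W" "\<phi> x = 1"
    and seg: "\<And>s. 0 \<le> s \<Longrightarrow> s \<le> 1 \<Longrightarrow> (1 - s) *\<^sub>R w + s *\<^sub>R w' \<in> W \<Longrightarrow> \<phi> ((1 - s) *\<^sub>R w + s *\<^sub>R w') \<noteq> 0"
  shows "htp W (rank_one_shift W \<phi> (w - x)) (rank_one_shift W \<phi> (w' - x))"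
proof (rule htp_segment[OF W(1) rank_one_shift_Op[OF W(1) \<phi>] rank_one_shift_Op[OF W(1) \<phi>]])
  fix s :: real assume s: "0 \<le> s" "s \<le> 1"
  have "(\<lambda>y\<in>W. (1 - s) *\<^sub>R rank_one_shift W \<phi> (w - x) y + s *\<^sub>R rank_one_shift W \<phi> (w' - x) y)
      = rank_one_shift W \<phi> (((1 - s) *\<^sub>R w + s *\<^sub>R w') - x)"
    by (rule ext) (simp add: rank_one_shift_def scale_right_distrib scale_right_diff_distrib smul_scaleR algebra_simps)
  then show "(\<lambda>y\<in>W. (1 - s) *\<^sub>R rank_one_shift W \<phi> (w - x) y + s *\<^sub>R rank_one_shift W \<phi> (w' - x) y) \<in> Em W"
    using rank_one_shift_Em[OF W \<phi> x] seg[OF s] by simp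
qed

text \<open>\<open>a\<close> and \<open>b\<close> are linearly independent over the reals. The lemma
  supplies the detour around 0 through a non-real scalar.\<close>

lemma segment_nonreal_nonzero:
  assumes "(a :: 'k) \<notin> \<real>" "b \<in> \<real>" "b \<noteq> 0"
  shows "of_real (1 - s) * a + of_real s * b \<noteq> 0" "of_real (1 - s) * b + of_real s * a \<noteq> 0"
proof -
  have *: "of_real r * a + of_real t * b \<noteq> 0" if "r \<noteq> 0 \<or> t \<noteq> 0" for r t
  proof
    assume 0: "of_real r * a + of_real t * b = 0"
    then have "r \<noteq> 0" using that assms(3) by auto
    then have "a = of_real (- t / r) * b"
      using 0 by (simp add: field_simps add_eq_0_iff)
    then show False using assms(1,2) by (metis Reals_mult Reals_of_real)
  qed
  show "of_real (1 - s) * a + of_real s * b \<noteq> 0"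
    by (rule *) linarith
  show "of_real (1 - s) * b + of_real s * a \<noteq> 0"
    using *[of s "1 - s"] by (simp add: add.commute)
qed

text \<open>The complement of the hyperplane is connected unless the field is real and \<open>W\<close> is the whole
  space; its two components then contain \<open>x\<close> and \<open>- x\<close>.\<close>

lemma htp_incl_or_reflection:
  assumes W: "subspace W" "closed W" and \<phi>: "bounded_functional \<phi>" and x: "x \<in> W" "\<phi> x = 1"
    and C: "C \<in> Em W" and C_id: "\<And>v. v \<in> W \<Longrightarrow> \<phi> v = 0 \<Longrightarrow> C v = v"
  shows "htp W C (incl W) \<or>
    (\<forall>a::'k. a \<in> \<real>) \<and> W = UNIV \<and> htp W C (rank_one_shift W \<phi> (- 2 *\<^sub>R x))"
proof -
  let ?E = "\<lambda>w. rank_one_shift W \<phi> (w - x)"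
  define w where "w = C x"
  note CO = Em_Op[OF C]
  have C_eq: "C = ?E w"
  proof (rule extensionalityI[OF Op_extensional[OF CO] Op_extensional[OF rank_one_shift_Op[OF W(1) \<phi>]]])
    fix y assume y: "y \<in> W"
    have "C (y - smul (\<phi> y) x) = y - smul (\<phi> y) x"
      using y x W(1) by (intro C_id) (simp_all add: subspace_diff subspace_scale functional_diff[OF \<phi>] functional_smul[OF \<phi>])
    then have "C y - smul (\<phi> y) w = y - smul (\<phi> y) x"
      using y x W(1) by (simp add: Op_diff[OF CO] Op_smul[OF CO] subspace_scale w_def)
    then have "C y = y - smul (\<phi> y) x + smul (\<phi> y) w"
      by (metis diff_add_cancel)
    then show "C y = ?E w y"
      using y by (simp add: rank_one_shift_def algebra_simps)
  qed
  have w: "\<not> (w \<in> W \<and> \<phi> w = 0)"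
  proof
    assume "w \<in> W \<and> \<phi> w = 0"
    then have 0: "C (w - x) = 0" "w - x \<in> W"
      using C_id[of w] x W(1) by (simp_all add: Op_diff[OF CO] subspace_diff) (simp add: w_def)
    obtain c where "c > 0" "c * norm (w - x) \<le> norm (C (w - x))"
      using Em_lower[OF C] 0(2) by metis
    then have "w - x = 0"
      using 0(1) by (simp add: mult_le_0_iff)
    then show False using \<open>w \<in> W \<and> \<phi> w = 0\<close> x(2) by simp
  qed
  have incl: "?E x = incl W"
    by (simp add: rank_one_shift_def incl_def cong: restrict_cong)
  have minus: "?E (- x) = rank_one_shift W \<phi> (- 2 *\<^sub>R x)"
    by (simp add: scaleR_2)
  have in_W: "htp W (?E u) (?E u')"
    if "u \<in> W" "u' \<in> W" "\<And>s. 0 \<le> s \<Longrightarrow> s \<le> 1 \<Longrightarrow> of_real (1 - s) * \<phi> u + of_real s * \<phi> u' \<noteq> 0" for u u'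
    by (rule rank_one_shift_htp[OF W \<phi> x])
      (use that(3) in \<open>simp add: functional_add[OF \<phi>] functional_scaleR[OF \<phi>]\<close>)
  have out_W: "htp W (?E u) (?E u')"
    if u: "u \<notin> W" and u': "u' \<in> W" "\<phi> u' \<noteq> 0" for u u'
  proof (rule rank_one_shift_htp[OF W \<phi> x])
    fix s :: real assume s: "(1 - s) *\<^sub>R u + s *\<^sub>R u' \<in> W"
    have "s = 1"
    proof (rule ccontr)
      assume "s \<noteq> 1"
      have "(1 - s) *\<^sub>R u + s *\<^sub>R u' - s *\<^sub>R u' \<in> W"
        using s u'(1) W(1) by (intro subspace_diff subspace_scaleR)
      then have "(1 / (1 - s)) *\<^sub>R (1 - s) *\<^sub>R u \<in> W"
        by (intro subspace_scaleR[OF W(1), of "(1 - s) *\<^sub>R u"]) simp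
      then show False using u \<open>s \<noteq> 1\<close> by (simp add: divide_simps)
    qed
    then show "\<phi> ((1 - s) *\<^sub>R u + s *\<^sub>R u') \<noteq> 0" using u'(2) by simp
  qed
  \<comment> \<open>Only a negative real \<open>\<phi> w\<close> places the kernel between
    \<open>w\<close> and \<open>x\<close>. Then one goes around it through a point outside
    \<open>W\<close> or through a non-real multiple of \<open>x\<close>; if neither exists, the
    segment from \<open>w\<close> to \<open>- x\<close> is free.\<close>
  consider "w \<notin> W" | "w \<in> W" "\<phi> w \<notin> \<real>" | r where "w \<in> W" "\<phi> w = of_real r" "r > 0"
    | r where "w \<in> W" "\<phi> w = of_real r" "r < 0"
    using w by (metis Reals_cases linorder_neqE_linordered_idom of_real_0)
  then show ?thesis
  proof cases
    case 1
    then show ?thesis using out_W[of w x] x C_eq incl by simp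
  next
    case 2
    then show ?thesis
      using in_W[of w x] segment_nonreal_nonzero(1)[of "\<phi> w" 1] x C_eq incl by simp
  next
    case 3
    have "(1 - s) * r + s \<noteq> 0" if "0 \<le> s" "s \<le> 1" for s
    proof (cases "s = 1")
      case False
      then have "(1 - s) * r > 0" using 3 that by simp
      then show ?thesis using that by linarith
    qed simp
    then have "of_real (1 - s) * \<phi> w + of_real s * \<phi> x \<noteq> 0" if "0 \<le> s" "s \<le> 1" for s
      using that 3 x(2) by (metis mult.right_neutral of_real_add of_real_eq_0_iff of_real_mult)
    then show ?thesis using in_W[of w x] 3 x C_eq incl by simp
  next
    case 4
    show ?thesis
    proof (cases "W = UNIV")
      case False
      then obtain p where "p \<notin> W" by blast
      then have "htp W (?E p) (?E w)" "htp W (?E p) (?E x)"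
        using out_W[of p w] out_W[of p x] 4 x by simp_all
      then show ?thesis using htp_trans[OF htp_sym] C_eq incl by metis
    next
      case True
      show ?thesis
      proof (cases "\<forall>a::'k. a \<in> \<real>")
        case True': True
        have "(1 - s) * r + s * (- 1) \<noteq> 0" if "0 \<le> s" "s \<le> 1" for s
        proof (cases "s = 1")
          case False
          then have "(1 - s) * r < 0" using 4 that by (simp add: mult_pos_neg)
          then show ?thesis using that by linarith
        qed simp
        then have "of_real (1 - s) * \<phi> w + of_real s * \<phi> (- x) \<noteq> 0" if "0 \<le> s" "s \<le> 1" for s
          using that 4 x(2) functional_diff[OF \<phi>, of 0 x] functional_zero[OF \<phi>]
          by (metis diff_0 of_real_1 of_real_add of_real_eq_0_iff of_real_minus of_real_mult)
        then have "htp W (?E w) (?E (- x))"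
          using 4 True by (intro in_W) auto
        then show ?thesis using C_eq minus True True' by simp
      next
        case False
        then obtain j :: 'k where j: "j \<notin> \<real>" by blast
        have "\<phi> (smul j x) = j" "smul j x \<in> W"
          using x W(1) by (simp_all add: functional_smul[OF \<phi>] subspace_scale)
        then have "htp W (?E w) (?E (smul j x))" "htp W (?E (smul j x)) (?E x)"
          using in_W[of w "smul j x"] in_W[of "smul j x" x]
            segment_nonreal_nonzero[OF j, of "of_real r"] segment_nonreal_nonzero[OF j, of 1] 4 x
          by simp_all
        then show ?thesis using htp_trans C_eq incl by metis
      qed
    qed
  qed
qed

text \<open>Removing one functional turns \<open>V\<close> into a space \<open>W\<close> in which it
  is a hyperplane, or equal to \<open>V\<close>. A reflection can appear only if
  \<open>W = UNIV\<close>; then \<open>W = Y\<close>, and no further extension is needed, so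
  reflections never have to be carried along.\<close>

lemma finite_codim_extension:
  assumes Y: "subspace Y" "closed Y" and S: "S \<in> Em Y"
    and \<Phi>: "finite \<Phi>" "\<And>\<phi>. \<phi> \<in> \<Phi> \<Longrightarrow> bounded_functional \<phi>"
    and V: "V = {y \<in> Y. \<forall>\<phi>\<in>\<Phi>. \<phi> y = 0}" and htp: "htp V (restrict S V) (incl V)"
  shows "htp Y S (incl Y) \<or>
    (\<forall>a::'k. a \<in> \<real>) \<and> Y = UNIV \<and>
    (\<exists>\<phi> x. bounded_functional \<phi> \<and> \<phi> x = 1 \<and> htp Y S (rank_one_shift Y \<phi> (- 2 *\<^sub>R x)))"
  using \<Phi> V htp
proof (induction \<Phi> arbitrary: V rule: finite_induct)
  case empty
  then show ?case
    using Op_extensional[OF Em_Op[OF S]] by (simp add: extensional_restrict)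
next
  case (insert \<phi> \<Phi>)
  define W where "W = {y \<in> Y. \<forall>\<phi>\<in>\<Phi>. \<phi> y = 0}"
  have \<phi>: "bounded_functional \<phi>" and \<Phi>: "\<And>\<psi>. \<psi> \<in> \<Phi> \<Longrightarrow> bounded_functional \<psi>"
    using insert.prems(1) by auto
  have V: "V = {y \<in> W. \<phi> y = 0}"
    unfolding insert.prems(2) W_def by auto
  have W: "subspace W" "closed W"
    unfolding W_def using common_kernel Y \<Phi> by blast+
  have WY: "W \<subseteq> Y" by (auto simp: W_def)
  have IH: ?case if "htp W (restrict S W) (incl W)"
    using insert.IH[OF \<Phi> W_def that] by blast
  show ?case
  proof (cases "\<exists>x\<in>W. \<phi> x \<noteq> 0")
    case False
    then have "V = W" using V by auto
    then show ?thesis using IH insert.prems(3) by blast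
  next
    case True
    then obtain x0 where "x0 \<in> W" "\<phi> x0 \<noteq> 0" by blast
    then obtain x where x: "x \<in> W" "\<phi> x = 1"
      using that[of "smul (1 / \<phi> x0) x0"] W(1) by (auto simp: subspace_scale functional_smul[OF \<phi>])
    have SW: "restrict S W \<in> Em W" by (rule Em_restrict[OF S WY W(1)])
    have "W \<inter> V = V" using V by auto
    then obtain C where C: "C \<in> Em W" "restrict C V = incl V" "htp W (restrict S W) C"
      using homotopy_extension[OF W(1) \<phi> x V SW] insert.prems(3) by (metis restrict_restrict)
    have "C v = v" if "v \<in> W" "\<phi> v = 0" for v
    proof -
      have "v \<in> V" using that V by simp
      then show ?thesis using fun_cong[OF C(2), of v] by (simp add: incl_def)
    qed
    from htp_incl_or_reflection[OF W \<phi> x C(1) this] show ?thesis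
    proof
      assume "htp W C (incl W)"
      then show ?thesis using IH htp_trans[OF C(3)] by blast
    next
      assume *: "(\<forall>a::'k. a \<in> \<real>) \<and> W = UNIV \<and> htp W C (rank_one_shift W \<phi> (- 2 *\<^sub>R x))"
      then have "Y = UNIV" "W = Y" using WY by auto
      moreover have "restrict S Y = S"
        using Op_extensional[OF Em_Op[OF S]] by (simp add: extensional_restrict)
      ultimately have "htp Y S (rank_one_shift Y \<phi> (- 2 *\<^sub>R x))"
        using * htp_trans[OF C(3)] by metis
      then show ?thesis using * \<phi> x \<open>Y = UNIV\<close> by blast
    qed
  qed
qed

end

section \<open>Reflections\<close>

context normed_space_over
begin

lemma bounded_functional_combination:
  assumes \<phi>: "bounded_functional \<phi>" and \<psi>: "bounded_functional \<psi>"
  shows "bounded_functional (\<lambda>y. a * \<phi> y + b * \<psi> y)"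
proof -
  obtain C where C: "\<And>x. norm (\<phi> x) \<le> C * norm x" using functional_bounded[OF \<phi>] by metis
  obtain D where D: "\<And>x. norm (\<psi> x) \<le> D * norm x" using functional_bounded[OF \<psi>] by metis
  have "norm (a * \<phi> x + b * \<psi> x) \<le> (norm a * C + norm b * D) * norm x" for x
  proof -
    have "norm (a * \<phi> x + b * \<psi> x) \<le> norm a * norm (\<phi> x) + norm b * norm (\<psi> x)"
      by (metis norm_mult norm_triangle_ineq)
    also have "\<dots> \<le> norm a * (C * norm x) + norm b * (D * norm x)"
      using C[of x] D[of x] by (intro add_mono mult_left_mono) auto
    finally show ?thesis by (simp add: algebra_simps)
  qed
  then show ?thesis
    unfolding bounded_functional_def
    by (auto simp: functional_add[OF \<phi>] functional_add[OF \<psi>] functional_smul[OF \<phi>] functional_smul[OF \<psi>] algebra_simps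
        intro!: exI[of _ "norm a * C + norm b * D"])
qed

text \<open>The operator is an involution, so an upper bound for it is also a lower bound.\<close>

lemma reflection_Em:
  assumes \<phi>: "bounded_functional \<phi>" and x: "\<phi> x = 1"
  shows "rank_one_shift UNIV \<phi> (- 2 *\<^sub>R x) \<in> Em UNIV"
proof -
  let ?R = "rank_one_shift UNIV \<phi> (- 2 *\<^sub>R x)"
  have R: "?R \<in> Op UNIV" by (rule rank_one_shift_Op[OF subspace_UNIV \<phi>])
  obtain C where C: "\<And>y. norm (?R y) \<le> C * norm y" using Op_bounded[OF R] by auto
  have "\<phi> (smul a (- 2 *\<^sub>R x)) = - 2 * a" for a
    using x by (simp only: functional_smul[OF \<phi>] functional_scaleR[OF \<phi>]) simp
  then have "?R (?R y) = y" for y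
    by (simp add: rank_one_shift_def functional_add[OF \<phi>] del: scaleR_minus_left)
  then have "norm y \<le> C * norm (?R y)" for y
    using C[of "?R y"] by simp
  then show ?thesis by (intro EmI'[OF R]) auto
qed

text \<open>With the functional fixed, the admissible vectors form an affine subspace, and likewise
  the functionals for a fixed vector. Both moves are combined through a vector \<open>z\<close> on
  which both functionals are 1. There is such a \<open>z\<close> unless \<open>\<psi>\<close>
  vanishes on the kernel of \<open>\<phi>\<close>; in that case \<open>\<psi>\<close> is a multiple
  of \<open>\<phi>\<close>, and rescaling \<open>y\<close> expresses the second reflection by
  \<open>\<phi>\<close>.\<close>

lemma reflections_htp:
  assumes \<phi>: "bounded_functional \<phi>" "\<phi> x = 1" and \<psi>: "bounded_functional \<psi>" "\<psi> y = 1"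
  shows "htp UNIV (rank_one_shift UNIV \<phi> (- 2 *\<^sub>R x)) (rank_one_shift UNIV \<psi> (- 2 *\<^sub>R y))"
proof -
  let ?R = "\<lambda>\<phi> x. rank_one_shift UNIV \<phi> (- 2 *\<^sub>R x)"
  have vec: "htp UNIV (?R \<phi> x) (?R \<phi> y)" if \<phi>: "bounded_functional \<phi>" and x: "\<phi> x = 1" and y: "\<phi> y = 1" for \<phi> x y
  proof (rule htp_segment[OF subspace_UNIV rank_one_shift_Op[OF subspace_UNIV \<phi>] rank_one_shift_Op[OF subspace_UNIV \<phi>]])
    fix s :: real
    have "\<phi> ((1 - s) *\<^sub>R x + s *\<^sub>R y) = 1"
      using x y by (simp add: functional_add[OF \<phi>] functional_scaleR[OF \<phi>])
    moreover have "(\<lambda>z\<in>UNIV. (1 - s) *\<^sub>R ?R \<phi> x z + s *\<^sub>R ?R \<phi> y z) = ?R \<phi> ((1 - s) *\<^sub>R x + s *\<^sub>R y)"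
      by (rule ext) (simp add: rank_one_shift_def scale_right_distrib scale_right_diff_distrib smul_scaleR algebra_simps)
    ultimately show "(\<lambda>z\<in>UNIV. (1 - s) *\<^sub>R ?R \<phi> x z + s *\<^sub>R ?R \<phi> y z) \<in> Em UNIV"
      using reflection_Em[OF \<phi>] by simp
  qed
  have functional: "htp UNIV (?R \<phi> x) (?R \<psi> x)"
    if \<phi>: "bounded_functional \<phi>" "\<phi> x = 1" and \<psi>: "bounded_functional \<psi>" "\<psi> x = 1" for \<phi> \<psi> x
  proof (rule htp_segment[OF subspace_UNIV rank_one_shift_Op[OF subspace_UNIV \<phi>(1)] rank_one_shift_Op[OF subspace_UNIV \<psi>(1)]])
    fix s :: real
    let ?\<theta> = "\<lambda>z. of_real (1 - s) * \<phi> z + of_real s * \<psi> z"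
    have eq: "smul (of_real r * a) z = r *\<^sub>R smul a z" for r a z
      by (metis scale_scale smul_of_real)
    have "(\<lambda>z\<in>UNIV. (1 - s) *\<^sub>R ?R \<phi> x z + s *\<^sub>R ?R \<psi> x z) = ?R ?\<theta> x"
      by (rule ext, simp add: rank_one_shift_def scale_left_distrib eq del: of_real_diff)
        (simp add: algebra_simps)
    moreover have "?\<theta> x = 1" using \<phi> \<psi> by simp
    ultimately show "(\<lambda>z\<in>UNIV. (1 - s) *\<^sub>R ?R \<phi> x z + s *\<^sub>R ?R \<psi> x z) \<in> Em UNIV"
      using reflection_Em[OF bounded_functional_combination[OF \<phi>(1) \<psi>(1)]] by simp
  qed
  show ?thesis
  proof (cases "\<exists>v. \<phi> v = 0 \<and> \<psi> v \<noteq> 0")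
    case True
    then obtain v where v: "\<phi> v = 0" "\<psi> v \<noteq> 0" by blast
    define z where "z = x + smul ((1 - \<psi> x) / \<psi> v) v"
    have z: "\<phi> z = 1" "\<psi> z = 1"
      using v \<phi> by (simp_all add: z_def functional_add[OF \<phi>(1)] functional_smul[OF \<phi>(1)]
          functional_add[OF \<psi>(1)] functional_smul[OF \<psi>(1)])
    have "htp UNIV (?R \<phi> x) (?R \<phi> z)" by (rule vec) (use \<phi> z in auto)
    also have "htp UNIV (?R \<phi> z) (?R \<psi> z)" by (rule functional) (use \<phi> \<psi> z in auto)
    also have "htp UNIV (?R \<psi> z) (?R \<psi> y)" by (rule vec) (use \<psi> z in auto)
    finally show ?thesis .
  next
    case False
    define k where "k = \<psi> x"
    have \<psi>_eq: "\<psi> z = \<phi> z * k" for z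
    proof -
      have "\<phi> (z - smul (\<phi> z) x) = 0"
        using \<phi>(2) by (simp add: functional_diff[OF \<phi>(1)] functional_smul[OF \<phi>(1)])
      then have "\<psi> (z - smul (\<phi> z) x) = 0" using False by blast
      then show ?thesis by (simp add: functional_diff[OF \<psi>(1)] functional_smul[OF \<psi>(1)] k_def)
    qed
    let ?z = "smul k y"
    have "\<phi> ?z = 1" using \<psi>_eq[of y] \<psi>(2) by (simp add: functional_smul[OF \<phi>(1)] mult.commute)
    moreover have "?R \<psi> y = ?R \<phi> ?z"
      by (rule ext) (simp add: rank_one_shift_def \<psi>_eq flip: smul_scaleR)
    ultimately show ?thesis using vec[OF \<phi>, of ?z] by simp
  qed
qed

text \<open>The reflected vector is not in the hyperplane, since it is not its own negative, and so
  spans the space together with it. The functional is read off from \<open>z - R z\<close>, a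
  multiple of \<open>2 *\<^sub>R y\<close>; its boundedness is inherited from
  \<open>R\<close>.\<close>

lemma reflection_is_rank_one_shift:
  assumes "reflection smul UNIV R"
  obtains \<psi> y where "bounded_functional \<psi>" "\<psi> y = 1" "R = rank_one_shift UNIV \<psi> (- 2 *\<^sub>R y)"
proof -
  obtain H y where R: "R \<in> Op UNIV" and y: "y \<noteq> 0" and H: "closed_hyperplane smul UNIV H"
    and R_H: "\<And>x. x \<in> H \<Longrightarrow> R x = x" and R_y: "R y = - y"
    using assms by (auto simp: reflection_def)
  obtain v where v: "v \<notin> H" "UNIV = span (insert v H)" and HS: "subspace H"
    using H by (auto simp: closed_hyperplane_def closed_subspace_def)
  have "y \<notin> H"
  proof
    assume "y \<in> H"
    then have "y = - y" using R_H R_y by metis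
    then show False using y by (simp add: eq_neg_iff_add_eq_0 flip: scaleR_2)
  qed
  then have "v \<in> span (insert y H)"
    using in_span_insert[of y v H] v(2) HS by (auto simp: span_eq_iff[THEN iffD2])
  then have "span (insert v H) \<subseteq> span (insert y H)"
    by (intro span_minimal) (auto intro: span_base)
  then have span: "z \<in> span (insert y H)" for z using v(2) by blast
  have "\<exists>a. z - R z = smul a (2 *\<^sub>R y)" for z
  proof -
    obtain a where "z - smul a y \<in> span H" using span[of z] span_breakdown_eq by blast
    then have "z - smul a y \<in> H" using HS by (simp add: span_eq_iff[THEN iffD2])
    then have "R z + smul a y = z - smul a y"
      using R_H[of "z - smul a y"] by (simp add: Op_diff[OF R subspace_UNIV] Op_smul[OF R] R_y)
    then have "z - R z = smul a y + smul a y" by (simp add: algebra_simps)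
    then show ?thesis by (intro exI[of _ a]) (simp add: scaleR_2 scale_right_distrib)
  qed
  then obtain \<psi> where \<psi>: "\<And>z. z - R z = smul (\<psi> z) (2 *\<^sub>R y)" by metis
  have inj: "a = b" if "smul a (2 *\<^sub>R y) = smul b (2 *\<^sub>R y)" for a b
    using that y by simp
  have "bounded_functional \<psi>"
    unfolding bounded_functional_def
  proof (intro conjI allI)
    fix z z' c
    have "smul (\<psi> (z + z')) (2 *\<^sub>R y) = smul (\<psi> z + \<psi> z') (2 *\<^sub>R y)"
      unfolding scale_left_distrib \<psi>[symmetric] by (simp add: Op_add[OF R])
    then show "\<psi> (z + z') = \<psi> z + \<psi> z'" by (rule inj)
    have "smul (\<psi> (smul c z)) (2 *\<^sub>R y) = smul (c * \<psi> z) (2 *\<^sub>R y)"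
      unfolding scale_scale[symmetric] \<psi>[symmetric] by (simp add: Op_smul[OF R] scale_right_diff_distrib)
    then show "\<psi> (smul c z) = c * \<psi> z" by (rule inj)
  next
    obtain C where C: "\<And>z. norm (R z) \<le> C * norm z" using Op_bounded[OF R] by auto
    have "norm (\<psi> z) \<le> (1 + C) / (2 * norm y) * norm z" for z
    proof -
      have "norm (\<psi> z) * (2 * norm y) = norm (z - R z)"
        unfolding \<psi> norm_smul by simp
      also have "\<dots> \<le> (1 + C) * norm z"
        using norm_triangle_ineq4[of z "R z"] C[of z] by (simp add: algebra_simps)
      finally show ?thesis using y by (simp add: field_simps)
    qed
    then show "\<exists>C. \<forall>z. norm (\<psi> z) \<le> C * norm z" by blast
  qed
  moreover have "\<psi> y = 1"
    by (rule inj, unfold \<psi>[symmetric]) (simp add: R_y scaleR_2)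
  moreover have "R = rank_one_shift UNIV \<psi> (- 2 *\<^sub>R y)"
  proof
    fix z
    have "R z = z - smul (\<psi> z) (2 *\<^sub>R y)" unfolding \<psi>[symmetric] by simp
    then show "R z = rank_one_shift UNIV \<psi> (- 2 *\<^sub>R y) z" by (simp add: rank_one_shift_def)
  qed
  ultimately show thesis by (rule that)
qed

end

section \<open>Operators on hereditarily indecomposable spaces\<close>

context normed_space_over
begin

text \<open>Bounded below on a subspace of finite codimension; the negation is usually called
  infinitely singular.\<close>

definition finitely_singular :: "'a set \<Rightarrow> ('a \<Rightarrow> 'a) \<Rightarrow> bool" where
  "finitely_singular Y A \<longleftrightarrow> (\<exists>\<Phi> c. finite \<Phi> \<and> (\<forall>\<phi>\<in>\<Phi>. bounded_functional \<phi>) \<and> c > 0 \<and>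
     (\<forall>y\<in>Y. (\<forall>\<phi>\<in>\<Phi>. \<phi> y = 0) \<longrightarrow> c * norm y \<le> norm (A y)))"

lemma bounded_linear_smul: "bounded_linear (smul c)"
  by (rule bounded_linear_intro[where K = "norm c"])
    (simp_all add: scale_right_distrib smul_scaleR norm_smul)

lemma subspace_closure:
  assumes F: "subspace F"
  shows "subspace (closure F)"
  unfolding subspace_def
proof (intro conjI ballI allI)
  show "0 \<in> closure F" using subspace_0[OF F] closure_subset by blast
  show "x + y \<in> closure F" if xy: "x \<in> closure F" "y \<in> closure F" for x y
  proof -
    obtain f g where "\<And>n. f n \<in> F" "f \<longlonglongrightarrow> x" "\<And>n. g n \<in> F" "g \<longlonglongrightarrow> y"
      using xy unfolding closure_sequential by metis
    then show ?thesis
      unfolding closure_sequential by (intro exI[of _ "\<lambda>n. f n + g n"]) (auto intro: subspace_add[OF F] tendsto_add)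
  qed
  show "smul c x \<in> closure F" if x: "x \<in> closure F" for c x
  proof -
    obtain f where "\<And>n. f n \<in> F" "f \<longlonglongrightarrow> x"
      using x unfolding closure_sequential by metis
    then show ?thesis
      unfolding closure_sequential
      by (intro exI[of _ "\<lambda>n. smul c (f n)"])
        (auto intro: subspace_scale[OF F] bounded_linear.tendsto[OF bounded_linear_smul])
  qed
qed

lemma Op_le_on_closure:
  assumes A: "A \<in> Op Y" and Y: "subspace Y" "closed Y" and F: "F \<subseteq> Y"
    and le: "\<And>w. w \<in> F \<Longrightarrow> norm (A w) \<le> e * norm w" and e: "0 \<le> e" and y: "y \<in> closure F"
  shows "norm (A y) \<le> e * norm y"
proof (rule field_le_epsilon)
  fix \<delta> :: real assume "\<delta> > 0"
  obtain C where C: "C > 0" "\<And>x. x \<in> Y \<Longrightarrow> norm (A x) \<le> C * norm x"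
    using Op_bounded[OF A] by metis
  \<comment> \<open>Replacing \<open>y\<close> by \<open>w\<close> costs
    \<open>C * norm (y - w)\<close> in \<open>A y\<close> and \<open>e * norm (y - w)\<close> in the
    bound.\<close>
  have "\<delta> / (C + e) > 0" using \<open>\<delta> > 0\<close> C(1) e by simp
  then obtain w where w: "w \<in> F" "dist w y < \<delta> / (C + e)"
    using y unfolding closure_approachable by blast
  have yY: "y \<in> Y" using y F Y(2) closure_minimal by blast
  have wY: "w \<in> Y" using w(1) F by blast
  have "norm (A y) \<le> norm (A (y - w)) + norm (A w)"
    using norm_triangle_ineq[of "A y - A w" "A w"] by (simp add: Op_diff[OF A Y(1) yY wY])
  also have "\<dots> \<le> C * norm (y - w) + e * norm w"
    using C(2)[of "y - w"] le[OF w(1)] subspace_diff[OF Y(1) yY wY] by simp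
  also have "e * norm w \<le> e * (norm y + norm (y - w))"
    using e norm_triangle_ineq4[of y "y - w"] by (intro mult_left_mono) auto
  also have "C * norm (y - w) + \<dots> = e * norm y + (C + e) * norm (y - w)"
    by (simp add: algebra_simps)
  also have "(C + e) * norm (y - w) \<le> \<delta>"
    using w(2) C(1) e by (simp add: dist_norm norm_minus_commute field_simps)
  finally show "norm (A y) \<le> e * norm y + \<delta>" by simp
qed

lemma functional_sum:
  "bounded_functional \<phi> \<Longrightarrow> \<phi> (\<Sum>i<n. smul (a i) (u i)) = (\<Sum>i<n. a i * \<phi> (u i))" for n :: nat
  by (induction n) (simp_all add: functional_add functional_smul functional_zero)

lemma span_lessThan:
  fixes n :: nat
  assumes "w \<in> span (u ` {..<n})"
  obtains a where "w = (\<Sum>i<n. smul (a i) (u i))"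
  using assms
proof (induction n arbitrary: w thesis)
  case 0
  then show ?case by simp
next
  case (Suc n)
  have "w \<in> span (insert (u n) (u ` {..<n}))"
    using Suc.prems(2) by (simp add: lessThan_Suc)
  then obtain k where "w - smul k (u n) \<in> span (u ` {..<n})"
    unfolding span_insert by blast
  then obtain a where a: "w - smul k (u n) = (\<Sum>i<n. smul (a i) (u i))"
    using Suc.IH by metis
  have "w = (\<Sum>i<n. smul (a i) (u i)) + smul k (u n)"
    unfolding a[symmetric] by simp
  then show ?case
    by (intro Suc.prems(1)[of "a(n := k)"]) simp
qed

text \<open>The triangular system \<open>\<phi> n (u n) = 1\<close>, \<open>\<phi> m (u n) = 0\<close> for \<open>m < n\<close> bounds the coefficients by
  constants that depend only on their index.\<close>

lemma triangular_coefficient_bound: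
  assumes \<phi>: "\<And>n. bounded_functional (\<phi> n)" "\<And>n x. norm (\<phi> n x) \<le> 2 * norm x"
    and u: "\<And>n. norm (u n) = 1" "\<And>n. \<phi> n (u n) = 1" "\<And>m n. m < n \<Longrightarrow> \<phi> m (u n) = 0"
    and w: "w = (\<Sum>i<N. smul (a i) (u i))" and n: "n < N"
  shows "norm (a n) \<le> 2 * 3 ^ n * norm w"
  using n
proof (induction n rule: less_induct)
  case (less n)
  have "\<phi> n w = (\<Sum>i<N. a i * \<phi> n (u i))"
    unfolding w by (rule functional_sum[OF \<phi>(1)])
  also have "\<dots> = (\<Sum>i<Suc n. a i * \<phi> n (u i))"
    using less.prems u(3) by (intro sum.mono_neutral_right) auto
  finally have "a n = \<phi> n w - (\<Sum>i<n. a i * \<phi> n (u i))"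
    using u(2) by simp
  then have "norm (a n) \<le> norm (\<phi> n w) + norm (\<Sum>i<n. a i * \<phi> n (u i))"
    by (metis norm_triangle_ineq4)
  \<comment> \<open>The constants obey the recursion: 2 plus twice the sum of all earlier ones. Its
    solution is \<open>2 * 3 ^ n\<close>.\<close>
  also have "norm (\<Sum>i<n. a i * \<phi> n (u i)) \<le> (\<Sum>i<n. 2 * 3 ^ i * norm w * 2)"
  proof (rule sum_norm_le)
    fix i assume i: "i \<in> {..<n}"
    have "norm (\<phi> n (u i)) \<le> 2" using \<phi>(2)[of n "u i"] u(1) by simp
    then show "norm (a i * \<phi> n (u i)) \<le> 2 * 3 ^ i * norm w * 2"
      unfolding norm_mult using less.IH[of i] less.prems i by (intro mult_mono) auto
  qed
  also have "\<dots> = 2 * (3 ^ n - 1) * norm w"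
    by (induction n) (simp_all add: algebra_simps)
  finally show ?case using \<phi>(2)[of n w] by (simp add: algebra_simps)
qed

text \<open>The inequality says that the inverse of addition is Lipschitz with constant
  \<open>1 / e\<close>. Read contrapositively, subspaces not in direct sum contain vectors that
  nearly cancel.\<close>

lemma topological_direct_sumI:
  assumes U: "subspace U" and V: "subspace V" and e: "e > 0"
    and sep: "\<And>u v. u \<in> U \<Longrightarrow> v \<in> V \<Longrightarrow> e * (norm u + norm v) \<le> norm (u + v)"
  shows "topological_direct_sum U V"
proof -
  let ?f = "\<lambda>(u, v). u + v :: 'a"
  have 0: "z = 0" if "z \<in> U" "z \<in> V" for z
  proof -
    have "- z \<in> V" using subspace_neg[OF V that(2)] .
    then have "e * (norm z + norm z) \<le> 0" using sep[of z "- z"] that by simp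
    then show ?thesis using e by (simp add: mult_le_0_iff)
  qed
  have lip: "dist p q \<le> dist (?f p) (?f q) / e" if pq: "p \<in> U \<times> V" "q \<in> U \<times> V" for p q
  proof -
    obtain u v u' v' where p: "p = (u, v)" "q = (u', v')" by (cases p, cases q)
    have "dist p q \<le> norm (u - u') + norm (v - v')"
      unfolding p dist_norm using norm_Pair_le[of "u - u'" "v - v'"] by simp
    also have "\<dots> \<le> norm ((u - u') + (v - v')) / e"
      using sep[of "u - u'" "v - v'"] pq e U V by (simp add: p subspace_diff field_simps)
    finally show ?thesis by (simp add: p dist_norm algebra_simps)
  qed
  have inj: "inj_on ?f (U \<times> V)"
  proof (rule inj_onI)
    fix p q assume pq: "p \<in> U \<times> V" "q \<in> U \<times> V" "?f p = ?f q"
    have "dist p q \<le> 0" using lip[OF pq(1,2)] unfolding pq(3) by simp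
    then show "p = q" by simp
  qed
  let ?g = "inv_into (U \<times> V) ?f"
  have cont: "continuous_on (?f ` (U \<times> V)) ?g"
    unfolding continuous_on_iff
  proof (intro ballI allI impI)
    fix x \<epsilon> :: real and x' assume x: "x' \<in> ?f ` (U \<times> V)" and \<epsilon>: "0 < \<epsilon>"
    have "dist (?g y) (?g x') < \<epsilon>" if y: "y \<in> ?f ` (U \<times> V)" "dist y x' < \<epsilon> * e" for y
    proof -
      have "dist (?g y) (?g x') \<le> dist y x' / e"
        using lip[OF inv_into_into[OF y(1)] inv_into_into[OF x]]
        unfolding f_inv_into_f[OF y(1)] f_inv_into_f[OF x] .
      also have "\<dots> < \<epsilon>" using y(2) e by (simp add: divide_less_eq)
      finally show ?thesis .
    qed
    then show "\<exists>d>0. \<forall>y\<in>?f ` (U \<times> V). dist y x' < d \<longrightarrow> dist (?g y) (?g x') < \<epsilon>"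
      using e \<epsilon> by (intro exI[of _ "\<epsilon> * e"]) auto
  qed
  have "homeomorphism (U \<times> V) (?f ` (U \<times> V)) ?f ?g"
  proof (rule homeomorphismI)
    show "continuous_on (U \<times> V) ?f"
      by (simp add: case_prod_beta continuous_intros)
  qed (use cont inj in \<open>auto simp: inv_into_into f_inv_into_f inv_into_f_f\<close>)
  moreover have "U \<inter> V = {0}"
    using 0 subspace_0[OF U] subspace_0[OF V] by auto
  ultimately show ?thesis
    unfolding topological_direct_sum_def by blast
qed

lemma hereditarily_indecomposable_almost_meet:
  assumes "hereditarily_indecomposable smul Y" and "U \<subseteq> Y" "V \<subseteq> Y"
    and "closed_subspace smul U" "infinite_dim smul U" "closed_subspace smul V" "infinite_dim smul V"
    and "e > 0"
  obtains u v where "u \<in> U" "v \<in> V" "norm (u + v) < e * (norm u + norm v)"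
proof -
  have "\<not> topological_direct_sum U V"
    using assms unfolding hereditarily_indecomposable_def by blast
  then show thesis
    using topological_direct_sumI[of U V e] assms that
    by (meson closed_subspace_def not_less)
qed

end

text \<open>Isolates the one fact whose proof differs between the real and the complex field;
  everything up to the classification is then proved once.\<close>

locale normed_space_norming = normed_space_over +
  assumes norming: "norm u = 1 \<Longrightarrow>
    \<exists>\<phi>. bounded_functional \<phi> \<and> \<phi> u = 1 \<and> (\<forall>x. norm (\<phi> x) \<le> 2 * norm x)"
begin

text \<open>\<open>A\<close> is not bounded below on the common kernel of the functionals chosen so
  far, which yields the next unit vector; a norming functional for it is then added. The rate
  \<open>6 ^ Suc n\<close> is meant to beat the coefficient growth \<open>3 ^ n\<close> and leave a
  geometric series.\<close>

lemma exists_singular_sequence: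
  assumes Y: "subspace Y" and A: "A \<in> Op Y" and sing: "\<not> finitely_singular Y A" and e: "e > 0"
  obtains u \<phi> where "\<And>n. u n \<in> Y" "\<And>n. norm (u n) = 1" "\<And>n. norm (A (u n)) \<le> e / 6 ^ Suc n"
    "\<And>n. bounded_functional (\<phi> n)" "\<And>n x. norm (\<phi> n x) \<le> 2 * norm x" "\<And>n. \<phi> n (u n) = 1"
    "\<And>m n. m < n \<Longrightarrow> \<phi> m (u n) = 0"
proof -
  define P where "P f n r \<longleftrightarrow> fst r \<in> Y \<and> norm (fst r) = 1 \<and> norm (A (fst r)) \<le> e / 6 ^ Suc n \<and>
      bounded_functional (snd r) \<and> (\<forall>x. norm (snd r x) \<le> 2 * norm x) \<and> snd r (fst r) = 1 \<and>
      (\<forall>m<n. snd (f m) (fst r) = 0)" for f :: "nat \<Rightarrow> 'b \<times> ('b \<Rightarrow> 'a)" and n r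
  have "\<exists>f. \<forall>n. P f n (f n)"
  proof (rule dependent_wellorder_choice)
    show "P f n r = P g n r" if "\<And>m. m < n \<Longrightarrow> f m = g m" for r f g n
      unfolding P_def using that by simp
    fix n f assume prev: "\<And>m. m < n \<Longrightarrow> P f m (f m)"
    let ?\<Phi> = "(snd \<circ> f) ` {..<n}" and ?d = "e / 6 ^ Suc n"
    have "finite ?\<Phi>" "\<forall>\<phi>\<in>?\<Phi>. bounded_functional \<phi>"
      using prev by (auto simp: P_def)
    moreover have d: "?d > 0" using e by simp
    ultimately obtain y where y: "y \<in> Y" "\<forall>\<phi>\<in>?\<Phi>. \<phi> y = 0" "norm (A y) < ?d * norm y"
      using sing unfolding finitely_singular_def by (meson not_less)
    have "y \<noteq> 0" using y(3) by auto
    define u where "u = (1 / norm y) *\<^sub>R y"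
    have u: "u \<in> Y" "norm u = 1"
      using y(1) \<open>y \<noteq> 0\<close> Y by (auto simp: u_def subspace_scaleR)
    have "norm (A u) \<le> ?d"
      using y(1,3) \<open>y \<noteq> 0\<close> by (simp add: u_def Op_scaleR[OF A] field_simps)
    moreover have "snd (f m) u = 0" if "m < n" for m
      using y(2) that prev[OF that] by (simp add: u_def P_def functional_scaleR)
    moreover obtain \<phi> where "bounded_functional \<phi>" "\<phi> u = 1" "\<forall>x. norm (\<phi> x) \<le> 2 * norm x"
      using norming[OF u(2)] by blast
    ultimately have "P f n (u, \<phi>)" using u by (simp add: P_def)
    then show "\<exists>r. P f n r" by blast
  qed
  then obtain f where f: "\<And>n. P f n (f n)" by blast
  show thesis
    by (rule that[of "fst \<circ> f" "snd \<circ> f"]) (use f in \<open>auto simp: P_def\<close>)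
qed

lemma exists_singular_subspace:
  assumes Y: "closed_subspace smul Y" and A: "A \<in> Op Y" and sing: "\<not> finitely_singular Y A" and e: "e > 0"
  obtains U where "U \<subseteq> Y" "closed_subspace smul U" "infinite_dim smul U"
    "\<And>y. y \<in> U \<Longrightarrow> norm (A y) \<le> e * norm y"
proof -
  have YS: "subspace Y" "closed Y" using Y by (auto simp: closed_subspace_def)
  obtain u \<phi> where u: "\<And>n. u n \<in> Y" "\<And>n. norm (u n) = 1" "\<And>n. norm (A (u n)) \<le> e / 6 ^ Suc n"
    and \<phi>: "\<And>n. bounded_functional (\<phi> n)" "\<And>n x. norm (\<phi> n x) \<le> 2 * norm x" "\<And>n. \<phi> n (u n) = 1"
      "\<And>m n. m < n \<Longrightarrow> \<phi> m (u n) = 0"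
    using exists_singular_sequence[OF YS(1) A sing e] by metis
  have coeff: "norm (a n) \<le> 2 * 3 ^ n * norm w"
    if "w = (\<Sum>i<N. smul (a i) (u i))" "n < N" for w a n N
    using triangular_coefficient_bound[of \<phi> u w a N n] \<phi> u(2) that by simp
  define F where "F = (\<Union>n. span (u ` {..<n}))"
  have mono: "span (u ` {..<m}) \<subseteq> span (u ` {..<n})" if "m \<le> n" for m n
    using that by (intro span_mono image_mono) auto
  have F: "subspace F"
    unfolding subspace_def
  proof (intro conjI ballI allI)
    show "0 \<in> F" by (auto simp: F_def span_zero)
    show "x + y \<in> F" if xy: "x \<in> F" "y \<in> F" for x y
    proof -
      obtain m n where "x \<in> span (u ` {..<m})" "y \<in> span (u ` {..<n})"
        using xy by (auto simp: F_def)
      then have "x + y \<in> span (u ` {..<max m n})"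
        using mono[of m "max m n"] mono[of n "max m n"] by (intro span_add) auto
      then show ?thesis by (auto simp: F_def)
    qed
    show "smul c x \<in> F" if "x \<in> F" for c x
      using that by (auto simp: F_def intro: span_scale)
  qed
  have FY: "F \<subseteq> Y"
    unfolding F_def using u(1) YS(1) by (intro UN_least span_minimal) auto
  have A_sum: "A (\<Sum>i<n. smul (a i) (u i)) = (\<Sum>i<n. smul (a i) (A (u i))) \<and> (\<Sum>i<n. smul (a i) (u i)) \<in> Y" for a n
    by (induction n) (simp_all add: Op_zero[OF A YS(1)] Op_add[OF A] Op_smul[OF A] u(1) YS(1)
        subspace_0 subspace_add subspace_scale)
  have A_F: "norm (A w) \<le> e * norm w" if wF: "w \<in> F" for w
  proof -
    obtain n where "w \<in> span (u ` {..<n})" using wF by (auto simp: F_def)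
    then obtain a where w: "w = (\<Sum>i<n. smul (a i) (u i))" by (rule span_lessThan)
    have "norm (A w) \<le> (\<Sum>i<n. norm (smul (a i) (A (u i))))"
      unfolding w using A_sum norm_sum by metis
    \<comment> \<open>The coefficient bound times the smallness of \<open>A (u i)\<close> contains
      \<open>2 * 3 ^ i / 6 ^ Suc i = (1 / 3) * (1 / 2) ^ i\<close>, with sum below 2/3.\<close>
    also have "\<dots> \<le> (\<Sum>i<n. e * norm w * ((1 / 3) * (1 / 2) ^ i))"
    proof (rule sum_mono)
      fix i assume i: "i \<in> {..<n}"
      have "norm (smul (a i) (A (u i))) \<le> (2 * 3 ^ i * norm w) * (e / 6 ^ Suc i)"
        unfolding norm_smul using coeff[OF w] i u(3)[of i] by (intro mult_mono) auto
      also have "(6 :: real) ^ Suc i = 6 * (2 ^ i * 3 ^ i)"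
        by (simp flip: power_mult_distrib)
      also have "2 * 3 ^ i * norm w * (e / (6 * (2 ^ i * 3 ^ i))) = e * norm w * ((1 / 3) * (1 / 2) ^ i)"
        by (simp add: power_divide field_simps)
      finally show "norm (smul (a i) (A (u i))) \<le> e * norm w * ((1 / 3) * (1 / 2) ^ i)"
        by simp
    qed
    also have "\<dots> = e * norm w * (2 / 3 * (1 - (1 / 2) ^ n))"
      by (induction n) (simp_all add: algebra_simps)
    also have "\<dots> \<le> e * norm w * 1"
      using e by (intro mult_left_mono) (auto simp: algebra_simps)
    finally show ?thesis by simp
  qed
  \<comment> \<open>Otherwise 0 would be a combination with coefficient -1 at \<open>u n\<close>,
    although the coefficients are bounded by a multiple of the norm of the combination.\<close>
  have not_in_span: "u n \<notin> span (u ` {..<n})" for n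
  proof
    assume "u n \<in> span (u ` {..<n})"
    then obtain a where a: "u n = (\<Sum>i<n. smul (a i) (u i))" by (rule span_lessThan)
    have "0 = (\<Sum>i<Suc n. smul ((a(n := - 1)) i) (u i))"
      by (simp add: a[symmetric])
    then have "norm ((a(n := - 1)) n) \<le> 2 * 3 ^ n * norm (0 :: 'b)"
      by (rule coeff) simp
    then show False by simp
  qed
  have indep: "independent (u ` {..<n}) \<and> card (u ` {..<n}) = n" for n
  proof (induction n)
    case (Suc n)
    have "u n \<notin> u ` {..<n}" using not_in_span[of n] span_base[of "u n"] by metis
    moreover have "independent (insert (u n) (u ` {..<n}))"
      using Suc not_in_span[of n] by (intro independent_insertI) simp_all
    moreover have "u ` {..<Suc n} = insert (u n) (u ` {..<n})" by (simp add: lessThan_Suc)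
    ultimately show ?case using Suc by simp
  qed (simp add: independent_empty)
  show thesis
  proof
    show "closure F \<subseteq> Y" using closure_minimal[OF FY YS(2)] .
    show "closed_subspace smul (closure F)"
      using subspace_closure[OF F] by (simp add: closed_subspace_def)
    show "infinite_dim smul (closure F)"
      unfolding infinite_dim_def
    proof
      assume "\<exists>B. finite B \<and> closure F \<subseteq> span B"
      then obtain B where B: "finite B" "closure F \<subseteq> span B" by blast
      have "u ` {..<Suc (card B)} \<subseteq> F"
        unfolding F_def by (auto intro: span_base)
      then have "u ` {..<Suc (card B)} \<subseteq> span B"
        using B(2) closure_subset by blast
      then have "card (u ` {..<Suc (card B)}) \<le> card B"
        using independent_span_bound[OF B(1)] indep by blast
      then show False using indep[of "Suc (card B)"] by simp
    qed
    show "norm (A y) \<le> e * norm y" if "y \<in> closure F" for y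
      using Op_le_on_closure[OF A YS FY A_F _ that] e by simp
  qed
qed

text \<open>\<open>A\<close> is small on \<open>U\<close>, \<open>B\<close> is small on
  \<open>V\<close>, and some \<open>u\<close> in \<open>U\<close> nearly cancels some
  \<open>v\<close> in \<open>V\<close>. Hence \<open>B u\<close> is close to \<open>- B v\<close>
  and \<open>A v\<close> to \<open>- A u\<close>, so both operators are small at both
  vectors.\<close>

lemma hereditarily_indecomposable_combination:
  assumes HI: "hereditarily_indecomposable smul Y" and Y: "closed_subspace smul Y"
    and A: "A \<in> Op Y" "\<not> finitely_singular Y A" and B: "B \<in> Op Y" "\<not> finitely_singular Y B"
    and rs: "\<bar>r\<bar> \<le> 1" "\<bar>s\<bar> \<le> 1"
    and lower: "\<And>y. y \<in> Y \<Longrightarrow> e * norm y \<le> norm (r *\<^sub>R A y + s *\<^sub>R B y)"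
  shows "e \<le> 0"
proof (rule ccontr)
  assume "\<not> e \<le> 0"
  then have e: "e > 0" by simp
  have YS: "subspace Y" using Y by (simp add: closed_subspace_def)
  obtain K where K: "K > 0" "\<And>x. x \<in> Y \<Longrightarrow> norm (A x) \<le> K * norm x" using Op_bounded[OF A(1)] by metis
  obtain L where L: "L > 0" "\<And>x. x \<in> Y \<Longrightarrow> norm (B x) \<le> L * norm x" using Op_bounded[OF B(1)] by metis
  \<comment> \<open>Adding the estimates at \<open>u\<close> and \<open>v\<close> avoids asking
    which of the two is large. They total at most \<open>(K + L + 2) * d * t\<close>, with
    \<open>t\<close> as below, and this \<open>d\<close> keeps that under half of
    \<open>e * t\<close>.\<close>
  define d where "d = e / (2 * (K + L + 4))"
  have d: "d > 0" using e K(1) L(1) by (simp add: d_def)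
  obtain U where U: "U \<subseteq> Y" "closed_subspace smul U" "infinite_dim smul U"
    "\<And>y. y \<in> U \<Longrightarrow> norm (A y) \<le> d * norm y"
    using exists_singular_subspace[OF Y A d] by metis
  obtain V where V: "V \<subseteq> Y" "closed_subspace smul V" "infinite_dim smul V"
    "\<And>y. y \<in> V \<Longrightarrow> norm (B y) \<le> d * norm y"
    using exists_singular_subspace[OF Y B d] by metis
  obtain u v where uv: "u \<in> U" "v \<in> V" "norm (u + v) < d * (norm u + norm v)"
    using hereditarily_indecomposable_almost_meet[OF HI U(1) V(1) U(2,3) V(2,3) d] by metis
  have uY: "u \<in> Y" and vY: "v \<in> Y" using uv U V by auto
  define t where "t = norm u + norm v"
  have t: "t > 0" using uv(3) d unfolding t_def by (smt (verit) mult_nonneg_nonpos norm_ge_zero)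
  have le: "e * norm y \<le> norm (A y) + norm (B y)" if "y \<in> Y" for y
  proof -
    have "norm (r *\<^sub>R A y + s *\<^sub>R B y) \<le> \<bar>r\<bar> * norm (A y) + \<bar>s\<bar> * norm (B y)"
      by (metis norm_scaleR norm_triangle_ineq)
    also have "\<dots> \<le> 1 * norm (A y) + 1 * norm (B y)"
      using rs by (intro add_mono mult_right_mono) auto
    finally show ?thesis using lower[OF that] by simp
  qed
  have Bu: "norm (B u) \<le> L * (d * t) + d * norm v"
  proof -
    have "B u = B (u + v) - B v" by (simp add: Op_add[OF B(1) uY vY])
    then have "norm (B u) \<le> norm (B (u + v)) + norm (B v)" by (metis norm_triangle_ineq4)
    moreover have "norm (B (u + v)) \<le> L * norm (u + v)" by (intro L(2) subspace_add YS uY vY)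
    moreover have "L * norm (u + v) \<le> L * (d * t)" using uv(3) L(1) by (simp add: t_def)
    ultimately show ?thesis using V(4)[OF uv(2)] by linarith
  qed
  have Av: "norm (A v) \<le> K * (d * t) + d * norm u"
  proof -
    have "A v = A (u + v) - A u" by (simp add: Op_add[OF A(1) uY vY])
    then have "norm (A v) \<le> norm (A (u + v)) + norm (A u)" by (metis norm_triangle_ineq4)
    moreover have "norm (A (u + v)) \<le> K * norm (u + v)" by (intro K(2) subspace_add YS uY vY)
    moreover have "K * norm (u + v) \<le> K * (d * t)" using uv(3) K(1) by (simp add: t_def)
    ultimately show ?thesis using U(4)[OF uv(1)] by linarith
  qed
  have "e * t \<le> (K + L + 2) * (d * t)"
    using le[OF uY] le[OF vY] U(4)[OF uv(1)] V(4)[OF uv(2)] Bu Av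
    by (simp add: t_def algebra_simps)
  also have "\<dots> \<le> (K + L + 4) * (d * t)"
    using d t by (intro mult_right_mono) auto
  also have "\<dots> = e / 2 * t"
    using K(1) L(1) by (simp add: d_def field_simps)
  finally show False using e t by simp
qed

end

section \<open>Segments from an embedding to the inclusion\<close>

context normed_space_over
begin

lemma Em_finitely_singular: "T \<in> Em Y \<Longrightarrow> finitely_singular Y T"
  unfolding finitely_singular_def by (rule Em_lower[of T Y], assumption, intro exI[of _ "{}"]) auto

lemma segment_to_incl_Op:
  assumes "subspace Y" "T \<in> Op Y"
  shows "(\<lambda>y\<in>Y. r *\<^sub>R T y + s *\<^sub>R y) \<in> Op Y"
  using Op_combination_real[OF assms Op_incl[OF assms(1)], of r s]
  by (simp add: incl_def cong: restrict_cong)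

text \<open>A family that works at \<open>x\<close> works for all nearby \<open>s\<close>, so
  compactness, in the form of the bisection principle \<open>Bolzano\<close>, leaves a finite union.
  The lower bounds may depend on \<open>s\<close>, which \<open>htp_segment\<close> allows.\<close>

lemma segment_common_kernel:
  assumes T: "T \<in> Op Y" and Y: "subspace Y"
    and sing: "\<And>s. 0 \<le> s \<Longrightarrow> s \<le> 1 \<Longrightarrow> finitely_singular Y (\<lambda>y\<in>Y. (1 - s) *\<^sub>R T y + s *\<^sub>R y)"
  obtains \<Phi> where "finite \<Phi>" "\<And>\<phi>. \<phi> \<in> \<Phi> \<Longrightarrow> bounded_functional \<phi>"
    "\<And>s. 0 \<le> s \<Longrightarrow> s \<le> 1 \<Longrightarrow>
      \<exists>c>0. \<forall>y\<in>Y. (\<forall>\<phi>\<in>\<Phi>. \<phi> y = 0) \<longrightarrow> c * norm y \<le> norm ((1 - s) *\<^sub>R T y + s *\<^sub>R y)"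
proof -
  define good where "good \<Phi> s \<longleftrightarrow>
      (\<exists>c>0. \<forall>y\<in>Y. (\<forall>\<phi>\<in>\<Phi>. \<phi> y = 0) \<longrightarrow> c * norm y \<le> norm ((1 - s) *\<^sub>R T y + s *\<^sub>R y))"
    for \<Phi> :: "('a \<Rightarrow> 'k) set" and s
  define P where "P a b \<longleftrightarrow> (\<exists>\<Phi>. finite \<Phi> \<and> (\<forall>\<phi>\<in>\<Phi>. bounded_functional \<phi>) \<and> (\<forall>s\<in>{a..b}. good \<Phi> s))" for a b
  obtain K where K: "K > 0" "\<And>y. y \<in> Y \<Longrightarrow> norm (y - T y) \<le> K * norm y"
    using Op_bounded[OF segment_to_incl_Op[OF Y T, of "-1" 1]] by auto
  have "P 0 1"
  proof (rule Bolzano)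
    fix a b c assume "P a b" "P b c"
    then obtain \<Phi> \<Psi> where "finite \<Phi>" "\<forall>\<phi>\<in>\<Phi>. bounded_functional \<phi>" "\<forall>s\<in>{a..b}. good \<Phi> s"
      "finite \<Psi>" "\<forall>\<phi>\<in>\<Psi>. bounded_functional \<phi>" "\<forall>s\<in>{b..c}. good \<Psi> s"
      unfolding P_def by blast
    moreover have "good (\<Phi> \<union> \<Psi>) s" if "good \<Phi> s \<or> good \<Psi> s" for s
      using that unfolding good_def by blast
    ultimately show "P a c"
      unfolding P_def by (intro exI[of _ "\<Phi> \<union> \<Psi>"]) (auto simp: not_le, metis atLeastAtMost_iff linear)
  next
    fix x :: real assume "0 \<le> x" "x \<le> 1"
    from sing[OF this] obtain \<Phi> c where \<Phi>: "finite \<Phi>" "\<forall>\<phi>\<in>\<Phi>. bounded_functional \<phi>" and c: "c > 0"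
      and lower: "\<And>y. y \<in> Y \<Longrightarrow> \<forall>\<phi>\<in>\<Phi>. \<phi> y = 0 \<Longrightarrow> c * norm y \<le> norm ((1 - x) *\<^sub>R T y + x *\<^sub>R y)"
      unfolding finitely_singular_def by auto
    \<comment> \<open>Moving the parameter by \<open>c / (2 * K)\<close> changes the operator by at
      most \<open>c / 2\<close>, half of its lower bound.\<close>
    have "good \<Phi> s" if s: "\<bar>s - x\<bar> \<le> c / (2 * K)" for s
      unfolding good_def
    proof (intro exI[of _ "c / 2"] conjI ballI impI)
      fix y assume y: "y \<in> Y" "\<forall>\<phi>\<in>\<Phi>. \<phi> y = 0"
      have "(1 - x) *\<^sub>R T y + x *\<^sub>R y = ((1 - s) *\<^sub>R T y + s *\<^sub>R y) - (s - x) *\<^sub>R (y - T y)"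
        by (simp add: algebra_simps)
      then have "norm ((1 - x) *\<^sub>R T y + x *\<^sub>R y) \<le> norm ((1 - s) *\<^sub>R T y + s *\<^sub>R y) + \<bar>s - x\<bar> * norm (y - T y)"
        by (metis norm_scaleR norm_triangle_ineq4)
      moreover have "\<bar>s - x\<bar> * norm (y - T y) \<le> c / (2 * K) * (K * norm y)"
        using s K c y by (intro mult_mono) auto
      ultimately show "c / 2 * norm y \<le> norm ((1 - s) *\<^sub>R T y + s *\<^sub>R y)"
        using lower[OF y] K(1) by (simp add: field_simps)
    qed (use c in simp)
    then have "P a b" if "a \<le> x" "x \<le> b" "b - a < c / (2 * K)" for a b
      using \<Phi> that unfolding P_def by (intro exI[of _ \<Phi>]) auto
    then show "\<exists>d>0. \<forall>a b. a \<le> x \<and> x \<le> b \<and> b - a < d \<longrightarrow> P a b"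
      using c K(1) by (intro exI[of _ "c / (2 * K)"]) auto
  qed simp
  then show thesis
    unfolding P_def good_def by (elim exE conjE, intro that) auto
qed

text \<open>On the common kernel the segment is itself a homotopy, which is then extended. The
  extension may end at one particular reflection; \<open>reflections_htp\<close> passes from it to
  all.\<close>

lemma segment_htp:
  assumes Y: "closed_subspace smul Y" and T: "T \<in> Em Y"
    and sing: "\<And>s. 0 \<le> s \<Longrightarrow> s \<le> 1 \<Longrightarrow> finitely_singular Y (\<lambda>y\<in>Y. (1 - s) *\<^sub>R T y + s *\<^sub>R y)"
  shows "htp Y T (incl Y) \<or>
    (\<forall>a::'k. a \<in> \<real>) \<and> Y = UNIV \<and> (\<forall>R. reflection smul UNIV R \<longrightarrow> htp UNIV T R)"
proof -
  have YS: "subspace Y" "closed Y" using Y by (auto simp: closed_subspace_def)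
  note TO = Em_Op[OF T]
  obtain \<Phi> where \<Phi>: "finite \<Phi>" "\<And>\<phi>. \<phi> \<in> \<Phi> \<Longrightarrow> bounded_functional \<phi>"
    and lower: "\<And>s. 0 \<le> s \<Longrightarrow> s \<le> 1 \<Longrightarrow>
      \<exists>c>0. \<forall>y\<in>Y. (\<forall>\<phi>\<in>\<Phi>. \<phi> y = 0) \<longrightarrow> c * norm y \<le> norm ((1 - s) *\<^sub>R T y + s *\<^sub>R y)"
    using segment_common_kernel[OF TO YS(1) sing] by metis
  define V where "V = {y \<in> Y. \<forall>\<phi>\<in>\<Phi>. \<phi> y = 0}"
  have V: "subspace V" "V \<subseteq> Y"
    using common_kernel(1)[OF YS(1) \<Phi>(2)] by (auto simp: V_def)
  have TV: "restrict T V \<in> Op V" by (rule Op_restrict[OF TO V(2,1)])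
  have "htp V (restrict T V) (incl V)"
  proof (rule htp_segment[OF V(1) TV Op_incl[OF V(1)]])
    fix s :: real assume "0 \<le> s" "s \<le> 1"
    from lower[OF this] obtain c where "c > 0"
      "\<forall>y\<in>Y. (\<forall>\<phi>\<in>\<Phi>. \<phi> y = 0) \<longrightarrow> c * norm y \<le> norm ((1 - s) *\<^sub>R T y + s *\<^sub>R y)" by blast
    then show "(\<lambda>y\<in>V. (1 - s) *\<^sub>R restrict T V y + s *\<^sub>R incl V y) \<in> Em V"
      by (intro EmI[where c = c] Op_combination_real[OF V(1) TV Op_incl[OF V(1)]])
        (auto simp: incl_def V_def)
  qed
  then have "htp Y T (incl Y) \<or> (\<forall>a::'k. a \<in> \<real>) \<and> Y = UNIV \<and>
      (\<exists>\<phi> x. bounded_functional \<phi> \<and> \<phi> x = 1 \<and> htp Y T (rank_one_shift Y \<phi> (- 2 *\<^sub>R x)))"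
    by (intro finite_codim_extension[OF YS T \<Phi>(1) _ V_def] \<Phi>(2))
  then show ?thesis
  proof (elim disjE conjE exE)
    fix \<phi> x assume real: "\<forall>a::'k. a \<in> \<real>" and "Y = UNIV"
      and \<phi>: "bounded_functional \<phi>" "\<phi> x = 1" and T\<phi>: "htp Y T (rank_one_shift Y \<phi> (- 2 *\<^sub>R x))"
    have "htp UNIV T R" if R: "reflection smul UNIV R" for R
    proof -
      obtain \<psi> y where \<psi>: "bounded_functional \<psi>" "\<psi> y = 1" "R = rank_one_shift UNIV \<psi> (- 2 *\<^sub>R y)"
        using reflection_is_rank_one_shift[OF R] by metis
      have "htp UNIV T (rank_one_shift UNIV \<phi> (- 2 *\<^sub>R x))"
        using T\<phi> \<open>Y = UNIV\<close> by simp
      also have "htp UNIV (rank_one_shift UNIV \<phi> (- 2 *\<^sub>R x)) R"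
        unfolding \<psi>(3) by (rule reflections_htp[OF \<phi> \<psi>(1,2)])
      finally show ?thesis .
    qed
    then show ?thesis using real \<open>Y = UNIV\<close> by blast
  qed blast
qed

text \<open>Scalar multiplication along the polygon from -1 through \<open>j\<close> to 1, which
  avoids 0.\<close>

lemma uminus_incl_htp:
  assumes Y: "subspace Y" and j: "(j :: 'k) \<notin> \<real>"
  shows "htp Y (\<lambda>y\<in>Y. - incl Y y) (incl Y)"
proof -
  define M where "M a = (\<lambda>y\<in>Y. smul a y)" for a
  have M: "M a \<in> Op Y" for a
    unfolding M_def by (rule restrict_in_OpI[OF Y, where C = "norm a"]) (simp_all add: norm_smul scale_right_distrib mult.commute)
  have htp: "htp Y (M a) (M b)" if nz: "\<And>s. of_real (1 - s) * a + of_real s * b \<noteq> 0" for a b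
  proof (rule htp_segment[OF Y M M])
    fix s :: real
    let ?c = "of_real (1 - s) * a + of_real s * b"
    have "smul (of_real r * c) y = r *\<^sub>R smul c y" for r c y
      by (metis scale_scale smul_of_real)
    then have "(\<lambda>y\<in>Y. (1 - s) *\<^sub>R M a y + s *\<^sub>R M b y) = M ?c"
      by (rule_tac ext) (simp add: M_def scale_left_distrib del: of_real_diff)
    moreover have "M ?c \<in> Em Y"
      by (rule EmI[OF M, where c = "norm ?c"]) (use nz[of s] in \<open>simp_all add: M_def norm_smul\<close>)
    ultimately show "(\<lambda>y\<in>Y. (1 - s) *\<^sub>R M a y + s *\<^sub>R M b y) \<in> Em Y" by simp
  qed
  have "htp Y (M (- 1)) (M j)"
    using segment_nonreal_nonzero(2)[OF j, of "- 1"] by (intro htp) simp_all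
  also have "htp Y (M j) (M 1)"
    using segment_nonreal_nonzero(1)[OF j, of 1] by (intro htp) simp_all
  finally show ?thesis
    by (simp add: M_def incl_def cong: restrict_cong)
qed

end

context normed_space_norming
begin

text \<open>If both segments fail, at \<open>s\<close> and at \<open>t\<close>, the weights
  \<open>1 - t\<close> and \<open>1 - s\<close> cancel \<open>T\<close> and leave
  \<open>(1 - t) * s + (1 - s) * t\<close> times the inclusion. This factor must vanish, which
  forces \<open>s\<close> to be an endpoint; but there the operator is \<open>T\<close> or the
  inclusion, both bounded below.\<close>

lemma segment_finitely_singular:
  assumes Y: "closed_subspace smul Y" and HI: "hereditarily_indecomposable smul Y" and T: "T \<in> Em Y"
  shows "(\<forall>s. 0 \<le> s \<and> s \<le> 1 \<longrightarrow> finitely_singular Y (\<lambda>y\<in>Y. (1 - s) *\<^sub>R T y + s *\<^sub>R y)) \<or>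
    (\<forall>s. 0 \<le> s \<and> s \<le> 1 \<longrightarrow> finitely_singular Y (\<lambda>y\<in>Y. (1 - s) *\<^sub>R (- T y) + s *\<^sub>R y))"
proof (rule ccontr)
  have YS: "subspace Y" using Y by (simp add: closed_subspace_def)
  note TO = Em_Op[OF T]
  assume "\<not> ?thesis"
  then obtain s t where s: "0 \<le> s" "s \<le> 1" and A: "\<not> finitely_singular Y (\<lambda>y\<in>Y. (1 - s) *\<^sub>R T y + s *\<^sub>R y)"
    and t: "0 \<le> t" "t \<le> 1" and B: "\<not> finitely_singular Y (\<lambda>y\<in>Y. (1 - t) *\<^sub>R (- T y) + t *\<^sub>R y)"
    by blast
  let ?A = "\<lambda>y\<in>Y. (1 - s) *\<^sub>R T y + s *\<^sub>R y" and ?B = "\<lambda>y\<in>Y. (1 - t) *\<^sub>R (- T y) + t *\<^sub>R y"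
  have AO: "?A \<in> Op Y" by (rule segment_to_incl_Op[OF YS TO])
  have BO: "?B \<in> Op Y"
    using segment_to_incl_Op[OF YS TO, of "- (1 - t)" t] by (simp only: scaleR_minus_left scaleR_minus_right)
  have pos: "0 \<le> (1 - t) * s" "0 \<le> (1 - s) * t" using s t by simp_all
  have "(1 - t) * s + (1 - s) * t \<le> 0"
  proof (rule hereditarily_indecomposable_combination[OF HI Y AO A BO B, of "1 - t" "1 - s"])
    fix y assume y: "y \<in> Y"
    have "(1 - t) *\<^sub>R ?A y + (1 - s) *\<^sub>R ?B y = ((1 - t) * s + (1 - s) * t) *\<^sub>R y"
      using y by (simp add: scaleR_right_distrib scaleR_right_diff_distrib
        scaleR_left_distrib mult.commute)
    then show "((1 - t) * s + (1 - s) * t) * norm y \<le> norm ((1 - t) *\<^sub>R ?A y + (1 - s) *\<^sub>R ?B y)"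
      using pos by simp
  qed (use s t in auto)
  then have "(1 - t) * s = 0" "(1 - s) * t = 0" using pos by linarith+
  then have "s = 0 \<or> s = 1" by auto
  moreover have "?A = T" if "s = 0"
    by (rule extensionalityI[OF restrict_extensional Op_extensional[OF TO]]) (simp add: that)
  moreover have "?A = incl Y" if "s = 1"
    by (simp add: that incl_def cong: restrict_cong)
  ultimately show False using A Em_finitely_singular T Em_incl[OF YS] by metis
qed

text \<open>If it is the segment from \<open>- T\<close> that works, negation carries the homotopy
  back and turns a reflection into an antireflection. Recording that the third alternative needs
  real scalars and \<open>Y = UNIV\<close> yields both supplementary claims.\<close>

theorem htp_classification:
  assumes Y: "closed_subspace smul Y" and HI: "hereditarily_indecomposable smul Y" and T: "T \<in> Em Y"
  shows "htp Y T (incl Y) \<or> htp Y T (\<lambda>y\<in>Y. - incl Y y) \<or>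
    (\<forall>a::'a. a \<in> \<real>) \<and> Y = UNIV \<and>
    ((\<forall>R. reflection smul Y R \<longrightarrow> htp Y T (compose Y (incl Y) R)) \<or>
     (\<forall>A. antireflection smul Y A \<longrightarrow> htp Y T (compose Y (incl Y) A)))"
proof -
  have YS: "subspace Y" using Y by (simp add: closed_subspace_def)
  have comp: "compose UNIV (incl UNIV) R = R" for R :: "'b \<Rightarrow> 'b"
    by (rule ext) (simp add: compose_def incl_def)
  let ?N = "\<lambda>y\<in>Y. - T y"
  have NN: "(\<lambda>y\<in>Y. - ?N y) = T"
    by (rule extensionalityI[OF restrict_extensional Op_extensional[OF Em_Op[OF T]]]) simp
  from segment_finitely_singular[OF Y HI T] show ?thesis
  proof
    assume "\<forall>s. 0 \<le> s \<and> s \<le> 1 \<longrightarrow> finitely_singular Y (\<lambda>y\<in>Y. (1 - s) *\<^sub>R T y + s *\<^sub>R y)"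
    then have "htp Y T (incl Y) \<or>
        (\<forall>a::'a. a \<in> \<real>) \<and> Y = UNIV \<and> (\<forall>R. reflection smul UNIV R \<longrightarrow> htp UNIV T R)"
      by (intro segment_htp[OF Y T]) auto
    then show ?thesis using comp by auto
  next
    assume "\<forall>s. 0 \<le> s \<and> s \<le> 1 \<longrightarrow> finitely_singular Y (\<lambda>y\<in>Y. (1 - s) *\<^sub>R (- T y) + s *\<^sub>R y)"
    then have "htp Y ?N (incl Y) \<or>
        (\<forall>a::'a. a \<in> \<real>) \<and> Y = UNIV \<and> (\<forall>R. reflection smul UNIV R \<longrightarrow> htp UNIV ?N R)"
      by (intro segment_htp[OF Y Em_uminus[OF YS T]]) (simp cong: restrict_cong)
    then show ?thesis
    proof
      assume "htp Y ?N (incl Y)"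
      from htp_uminus[OF YS this] show ?thesis unfolding NN by blast
    next
      assume *: "(\<forall>a::'a. a \<in> \<real>) \<and> Y = UNIV \<and> (\<forall>R. reflection smul UNIV R \<longrightarrow> htp UNIV ?N R)"
      have "htp Y T (compose Y (incl Y) A)" if A: "antireflection smul Y A" for A
      proof -
        obtain R where R: "reflection smul Y R" "A = (\<lambda>y\<in>Y. - R y)"
          using A by (auto simp: antireflection_def)
        then have "htp Y ?N R" using * by auto
        from htp_uminus[OF YS this] have "htp Y T A" unfolding NN R(2) .
        then show ?thesis using * comp by simp
      qed
      then show ?thesis using * by blast
    qed
  qed
qed

end

section \<open>The real and the complex case\<close>

lemma normed_space_norming_scaleR:
  "normed_space_norming ((*\<^sub>R) :: real \<Rightarrow> 'a::real_normed_vector \<Rightarrow> 'a)"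
proof (intro normed_space_norming.intro normed_space_over_scaleR normed_space_norming_axioms.intro)
  interpret R: normed_space_over "(*\<^sub>R) :: real \<Rightarrow> 'a \<Rightarrow> 'a" by (rule normed_space_over_scaleR)
  fix u :: 'a assume u: "norm u = 1"
  obtain f where f: "linear f" "f u = norm u" "\<And>x. \<bar>f x\<bar> \<le> norm x"
    using exists_norming_functional[of u] by metis
  have "norm (f x) \<le> 2 * norm x" for x
    using f(3)[of x] norm_ge_zero[of x] unfolding real_norm_def by linarith
  moreover from this have "R.bounded_functional f"
    unfolding R.bounded_functional_def using f(1) by (auto simp: linear_add linear_cmul)
  ultimately show "\<exists>\<phi>. R.bounded_functional \<phi> \<and> \<phi> u = 1 \<and> (\<forall>x. norm (\<phi> x) \<le> 2 * norm x)"
    using f(2) u by (intro exI[of _ f]) auto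
qed

text \<open>Complexification: \<open>g\<close> is complex-linear with real part \<open>f\<close>,
  and bounding its two parts separately gives the factor 2. Since \<open>norm (g u)\<close> is at
  least its real part 1, dividing by \<open>g u\<close> makes the value at \<open>u\<close> equal to
  1 and keeps the bound.\<close>

lemma normed_space_norming_complex:
  fixes smul :: "complex \<Rightarrow> 'a::real_normed_vector \<Rightarrow> 'a"
  assumes "normed_space_over smul"
  shows "normed_space_norming smul"
proof (intro normed_space_norming.intro assms normed_space_norming_axioms.intro)
  interpret C: normed_space_over smul by (rule assms)
  fix u :: 'a assume u: "norm u = 1"
  obtain f where f: "linear f" "f u = norm u" "\<And>x. \<bar>f x\<bar> \<le> norm x"
    using exists_norming_functional[of u] by metis
  define g where "g x = Complex (f x) (- f (smul \<i> x))" for x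
  have smul_eq: "smul c x = Re c *\<^sub>R x + Im c *\<^sub>R smul \<i> x" for c x
  proof -
    have "smul c x = smul (of_real (Re c) + of_real (Im c) * \<i>) x"
      by (metis complex_eq mult.commute)
    also have "\<dots> = smul (of_real (Re c)) x + smul (of_real (Im c)) (smul \<i> x)"
      by (simp only: C.scale_left_distrib C.scale_scale)
    finally show ?thesis by (simp only: C.smul_of_real)
  qed
  have ii: "smul \<i> (smul \<i> x) = - x" for x by simp
  have g_add: "g (x + y) = g x + g y" for x y
    by (simp add: g_def C.scale_right_distrib linear_add[OF f(1)] complex_eq_iff)
  have g_smul: "g (smul c x) = c * g x" for c x
  proof -
    have "smul \<i> (smul c x) = Re c *\<^sub>R smul \<i> x - Im c *\<^sub>R x"
      by (subst smul_eq[of c]) (simp add: C.scale_right_distrib C.smul_scaleR)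
    then have "f (smul \<i> (smul c x)) = Re c * f (smul \<i> x) - Im c * f x"
      by (simp only: linear_diff[OF f(1)] linear_cmul[OF f(1)] real_scaleR_def)
    moreover have "f (smul c x) = Re c * f x + Im c * f (smul \<i> x)"
      unfolding smul_eq[of c x] by (simp add: linear_add[OF f(1)] linear_cmul[OF f(1)])
    ultimately show ?thesis
      by (simp add: g_def complex_eq_iff)
  qed
  have g_le: "norm (g x) \<le> 2 * norm x" for x
    using cmod_le[of "g x"] f(3)[of x] f(3)[of "smul \<i> x"] by (simp add: g_def C.norm_smul)
  have gu: "1 \<le> norm (g u)"
    using abs_Re_le_cmod[of "g u"] f(2) u by (simp add: g_def)
  then have gu0: "g u \<noteq> 0" by auto
  have le: "norm (g x / g u) \<le> 2 * norm x" for x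
  proof -
    have "norm (g x) * 1 \<le> 2 * norm x * norm (g u)"
      using g_le[of x] gu by (intro mult_mono) auto
    then show ?thesis using gu0 by (simp add: norm_divide divide_le_eq)
  qed
  then have "C.bounded_functional (\<lambda>x. g x / g u)"
    unfolding C.bounded_functional_def by (auto simp: g_add g_smul add_divide_distrib)
  then show "\<exists>\<phi>. C.bounded_functional \<phi> \<and> \<phi> u = 1 \<and> (\<forall>x. norm (\<phi> x) \<le> 2 * norm x)"
    using le gu0 by (intro exI[of _ "\<lambda>x. g x / g u"]) simp
qed

lemma complex_htp_incl:
  fixes smul :: "complex \<Rightarrow> 'a::real_normed_vector \<Rightarrow> 'a"
  assumes "normed_space_over smul" "closed_subspace smul Y" "hereditarily_indecomposable smul Y"
    "T \<in> Emb smul Y UNIV"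
  shows "homotopic_in_Emb smul Y UNIV T (incl Y)"
proof -
  interpret normed_space_norming smul by (rule normed_space_norming_complex[OF assms(1)])
  have "\<i> \<notin> \<real>" by (simp add: complex_is_Real_iff)
  then have "htp Y (\<lambda>y\<in>Y. - incl Y y) (incl Y)"
    using assms(2) by (intro uminus_incl_htp[of _ \<i>]) (auto simp: closed_subspace_def)
  then show ?thesis
    using htp_classification[OF assms(2-4)] htp_trans \<open>\<i> \<notin> \<real>\<close> by blast
qed

theorem theorem5p2:
  shows
   "(\<forall>(Y :: 'a::banach set) T.
      infinite_dim (*\<^sub>R) UNIV \<longrightarrow>
      closed_subspace (*\<^sub>R) Y \<longrightarrow>
      hereditarily_indecomposable (*\<^sub>R) Y \<longrightarrow>
      T \<in> Emb (*\<^sub>R) Y UNIV \<longrightarrow>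
        (homotopic_in_Emb (*\<^sub>R) Y UNIV T (incl Y) \<or>
         homotopic_in_Emb (*\<^sub>R) Y UNIV T (\<lambda>y\<in>Y. - incl Y y) \<or>
         (\<forall>R. reflection (*\<^sub>R) Y R \<longrightarrow>
            homotopic_in_Emb (*\<^sub>R) Y UNIV T (compose Y (incl Y) R)) \<or>
         (\<forall>A. antireflection (*\<^sub>R) Y A \<longrightarrow>
            homotopic_in_Emb (*\<^sub>R) Y UNIV T (compose Y (incl Y) A))) \<and>
        (Y \<noteq> UNIV \<longrightarrow>
         homotopic_in_Emb (*\<^sub>R) Y UNIV T (incl Y) \<or>
         homotopic_in_Emb (*\<^sub>R) Y UNIV T (\<lambda>y\<in>Y. - incl Y y)))
    \<and>
    (\<forall>(smul :: complex \<Rightarrow> 'b::banach \<Rightarrow> 'b) (Y :: 'b set) T.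
      normed_space_over smul \<longrightarrow>
      infinite_dim smul UNIV \<longrightarrow>
      closed_subspace smul Y \<longrightarrow>
      hereditarily_indecomposable smul Y \<longrightarrow>
      T \<in> Emb smul Y UNIV \<longrightarrow>
        (homotopic_in_Emb smul Y UNIV T (incl Y) \<or>
         homotopic_in_Emb smul Y UNIV T (\<lambda>y\<in>Y. - incl Y y) \<or>
         (\<forall>R. reflection smul Y R \<longrightarrow>
            homotopic_in_Emb smul Y UNIV T (compose Y (incl Y) R)) \<or>
         (\<forall>A. antireflection smul Y A \<longrightarrow>
            homotopic_in_Emb smul Y UNIV T (compose Y (incl Y) A))) \<and>
        (Y \<noteq> UNIV \<longrightarrow>
         homotopic_in_Emb smul Y UNIV T (incl Y) \<or>
         homotopic_in_Emb smul Y UNIV T (\<lambda>y\<in>Y. - incl Y y)) \<and>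
        homotopic_in_Emb smul Y UNIV T (incl Y))"
  using normed_space_norming.htp_classification[OF normed_space_norming_scaleR]
    complex_htp_incl by blast

end
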